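(* Let $G$ be a compact Lie group and let $\rho:G\to\mathrm{GL}(V)$ be a finite-dimensional real or complex representation leaving the inner product $\langle\cdot,\cdot\rangle$ on $V$ invariant. Let $n,n'\geq0$ be integers, let $\mathcal A$ be a finite-dimensional inner product space over the same field as $V$, and let $\tau:\mathcal A\to V^{\otimes n}\otimes(V^* )^{\otimes n'}$ be a linear map with adjoint $\tau^*:V^{\otimes n}\otimes(V^* )^{\otimes n'}\to\mathcal A$. There exists a unique linear map $\mathrm{Wg}:\mathcal A\to\mathcal A$ satisfying: 1. $\tau^*\circ\tau\circ\mathrm{Wg}\circ\tau^*\circ\tau=\tau^*\circ\tau$, 2. $\mathrm{Wg}\circ\tau^*\circ\tau\circ\mathrm{Wg}=\mathrm{Wg}$, 3. $\mathrm{Wg}^*\circ\tau^*\circ\tau=\tau^*\circ\tau\circ\mathrm{Wg}$, 4. $\tau^*\circ\tau\circ\mathrm{Wg}^*=\mathrm{Wg}\circ\tau^*\circ\tau$. If the image of $\tau$ is the space of invariants $\bigl(V^{\otimes n}\otimes(V^* )^{\otimes n'}\bigr)^G$, then $$T(1)=\tau\circ\mathrm{Wg}\circ\tau^*,$$ where $T(1)=\int_G\rho^{\otimes n,\otimes n'}(g)\,dg$. In particular, the coefficients of $T(1)$ with respect to an orthonormal basis of $V$ are given by $$T(1)_{\mathbf{ij}}=\sum_{k,l}\tau(a_k)_{\mathbf i}\,\overline{\tau(a_l)_{\mathbf j}}\,\langle\mathrm{Wg}(a_l),a_k\rangle,$$ where $\{a_k\}$ is an orthonormal basis of $\mathcal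 A$.
   Context: $dg$ is the normalized Haar measure on $G$. $\rho^{\otimes n,\otimes n'}=\rho^{\otimes n}\otimes(\rho^* )^{\otimes n'}$ is the tensor representation on $V^{\otimes n}\otimes(V^* )^{\otimes n'}$, where $\rho^*(g)=\rho(g^{-1})^*$ is the dual representation (transpose of $\rho(g^{-1})$ on $V^*$). Inner products are linear in the first argument (and conjugate-linear in the second in the complex case). $V^*$ carries the dual inner product, and $V^{\otimes n}\otimes(V^* )^{\otimes n'}$ carries the inner product $\langle v\otimes\alpha,w\otimes\beta\rangle=\langle v_1,w_1\rangle\cdots\langle v_n,w_n\rangle\,\langle\alpha_1,\beta_1\rangle\cdots\langle\alpha_{n'},\beta_{n'}\rangle$ for $v=v_1\otimes\cdots\otimes v_n$, $\alpha=\alpha_1\otimes\cdots\otimes\alpha_{n'}$, etc. (under $V^{\otimes n}\otimes(V^* )^{\otimes n'}\cong\mathrm{Hom}(V^{\otimes n'},V^{\otimes n})$ it is $\langle S_1,S_2\rangle=\mathrm{tr}(S_2^*S_1)$). Adjoints $\tau^*$, $\mathrm{Wg}^*$ are taken with respect to these inner products. An orthonormal basis of $V$ and its dual basis induce an orthonormal basis $\{e_{\mathbf i}\}$ of $V^{\otimes n}\otimes(V^* )^{\otimes n'}$ indexed by multi-indices $\mathbf i=(i_1,\dots,i_n;i'_1,\dots,i'_{n'})$; $x_{\mathbf i}$ denotes the corresponding component of $x$, and $T(1)_{\mathbf{ij}}$ is the $\mathbf i$-component of $T(1)e_{\mathbf j}$. *)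

theory Defs
  imports "HOL-Analysis.Analysis" "HOL-Algebra.Coset"
begin

section \<open>The scalar field\<close>

text \<open>
  The real and the complex numbers are treated uniformly.  By the Gelfand--Mazur theorem a field
  with a multiplicative real norm is isomorphic to one of them, and the axiom
  \<open>mult_cnjg\<close> determines \<open>cnjg\<close> (the identity on the reals, complex
  conjugation on the complex numbers).  The superclass \<open>euclidean_space\<close> makes the Bochner
  integral of scalar-valued functions available.
\<close>

class real_or_complex = real_normed_field + euclidean_space +
  fixes cnjg :: "'a \<Rightarrow> 'a"
  assumes cnjg_add: "cnjg (x + y) = cnjg x + cnjg y"
    and cnjg_mult: "cnjg (x * y) = cnjg x * cnjg y"
    and cnjg_cnjg: "cnjg (cnjg x) = x"
    and mult_cnjg: "x * cnjg x = (norm x)\<^sup>2 *\<^sub>R 1"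

instantiation real :: real_or_complex
begin
definition cnjg_real :: "real \<Rightarrow> real" where "cnjg_real x = x"
instance by standard (simp_all add: cnjg_real_def power2_eq_square)
end

instantiation complex :: real_or_complex
begin
definition cnjg_complex :: "complex \<Rightarrow> complex" where "cnjg_complex = cnj"
instance by standard (simp_all add: cnjg_complex_def complex_norm_square scaleR_conv_of_real flip: of_real_power)
end

section \<open>Finite-dimensional inner product spaces\<close>

text \<open>Linear in the first argument, conjugate-linear in the second.\<close>

locale fd_inner_product_space = vector_space smul
  for smul :: "'k::real_or_complex \<Rightarrow> 'v::ab_group_add \<Rightarrow> 'v" +
  fixes ip :: "'v \<Rightarrow> 'v \<Rightarrow> 'k"
  assumes finite_dim: "\<exists>B. finite B \<and> span B = UNIV"
    and ip_add_left: "ip (x + y) z = ip x z + ip y z"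
    and ip_scale_left: "ip (smul c x) y = c * ip x y"
    and ip_commute: "ip x y = cnjg (ip y x)"
    and ip_pos: "x \<noteq> 0 \<Longrightarrow> \<exists>r>0. ip x x = of_real r"

definition ip_norm :: "('v \<Rightarrow> 'v \<Rightarrow> 'k::real_or_complex) \<Rightarrow> 'v \<Rightarrow> real" where
  "ip_norm ip v = sqrt (norm (ip v v))"

definition ip_topology :: "('v::ab_group_add \<Rightarrow> 'v \<Rightarrow> 'k::real_or_complex) \<Rightarrow> 'v topology" where
  "ip_topology ip = Metric_space.mtopology UNIV (\<lambda>v w. ip_norm ip (v - w))"

text \<open>As for the real \<^const>\<open>adjoint\<close> of the library.\<close>

definition adjoint_map ::
  "('a \<Rightarrow> 'a \<Rightarrow> 'k) \<Rightarrow> ('b \<Rightarrow> 'b \<Rightarrow> 'k) \<Rightarrow> ('a \<Rightarrow> 'b) \<Rightarrow> 'b \<Rightarrow> 'a" where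
  "adjoint_map ipA ipB f = (SOME h. \<forall>x y. ipB (f x) y = ipA x (h y))"

definition orthonormal_basis ::
  "('k::real_or_complex \<Rightarrow> 'v::ab_group_add \<Rightarrow> 'v) \<Rightarrow> ('v \<Rightarrow> 'v \<Rightarrow> 'k) \<Rightarrow> nat \<Rightarrow> (nat \<Rightarrow> 'v) \<Rightarrow> bool"
  where
  "orthonormal_basis smul ip m e \<longleftrightarrow>
     (\<forall>i<m. \<forall>j<m. ip (e i) (e j) = (if i = j then 1 else 0)) \<and>
     module.span smul (e ` {..<m}) = UNIV"

section \<open>The dual space\<close>

definition dual_space ::
  "('k::field \<Rightarrow> 'v::ab_group_add \<Rightarrow> 'v) \<Rightarrow> ('v \<Rightarrow> 'k) set" where
  "dual_space smul = {\<alpha>. Vector_Spaces.linear smul (*) \<alpha>}"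

definition riesz_vector :: "('v \<Rightarrow> 'v \<Rightarrow> 'k) \<Rightarrow> ('v \<Rightarrow> 'k) \<Rightarrow> 'v" where
  "riesz_vector ip \<alpha> = (THE a. \<forall>v. \<alpha> v = ip v a)"

text \<open>
  The Riesz map is conjugate-linear, so the arguments are swapped to make the
  dual inner product linear in its first argument.
\<close>

definition dual_ip :: "('v \<Rightarrow> 'v \<Rightarrow> 'k) \<Rightarrow> ('v \<Rightarrow> 'k) \<Rightarrow> ('v \<Rightarrow> 'k) \<Rightarrow> 'k" where
  "dual_ip ip \<alpha> \<beta> = ip (riesz_vector ip \<beta>) (riesz_vector ip \<alpha>)"

definition dual_basis ::
  "('k::field \<Rightarrow> 'v::ab_group_add \<Rightarrow> 'v) \<Rightarrow> nat \<Rightarrow> (nat \<Rightarrow> 'v) \<Rightarrow> nat \<Rightarrow> 'v \<Rightarrow> 'k" where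
  "dual_basis smul m e i = (\<lambda>v. module.representation smul (e ` {..<m}) v (e i))"

section \<open>Mixed tensor products\<close>

text \<open>
  A simple tensor of \<open>n\<close> vectors and \<open>n'\<close> covectors is given by two lists; this allows
  \<open>n\<close> and \<open>n'\<close> to be arbitrary natural numbers, including 0.
\<close>

definition tensor_args ::
  "('k::field \<Rightarrow> 'v::ab_group_add \<Rightarrow> 'v) \<Rightarrow> nat \<Rightarrow> nat \<Rightarrow> ('v list \<times> ('v \<Rightarrow> 'k) list) set" where
  "tensor_args smul n n' =
     {(vs, \<alpha>s). length vs = n \<and> length \<alpha>s = n' \<and> set \<alpha>s \<subseteq> dual_space smul}"

definition mixed_multilinear ::
  "('k::field \<Rightarrow> 'v::ab_group_add \<Rightarrow> 'v) \<Rightarrow> ('k \<Rightarrow> 'w::ab_group_add \<Rightarrow> 'w) \<Rightarrow> nat \<Rightarrow> nat \<Rightarrow>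
   ('v list \<Rightarrow> ('v \<Rightarrow> 'k) list \<Rightarrow> 'w) \<Rightarrow> bool" where
  "mixed_multilinear smul scaleW n n' f \<longleftrightarrow>
     (\<forall>(vs, \<alpha>s) \<in> tensor_args smul n n'.
        (\<forall>i<n. \<forall>x y c.
           f (vs[i := x + y]) \<alpha>s = f (vs[i := x]) \<alpha>s + f (vs[i := y]) \<alpha>s \<and>
           f (vs[i := smul c x]) \<alpha>s = scaleW c (f (vs[i := x]) \<alpha>s)) \<and>
        (\<forall>j<n'. \<forall>\<beta> \<in> dual_space smul. \<forall>\<gamma> \<in> dual_space smul. \<forall>c.
           f vs (\<alpha>s[j := (\<lambda>v. \<beta> v + \<gamma> v)]) = f vs (\<alpha>s[j := \<beta>]) + f vs (\<alpha>s[j := \<gamma>]) \<and>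
           f vs (\<alpha>s[j := (\<lambda>v. c * \<beta> v)]) = scaleW c (f vs (\<alpha>s[j := \<beta>]))))"

text \<open>
  The space of tensors with \<open>n\<close> factors \<open>V\<close> and \<open>n'\<close> factors \<open>V\<^sup>*\<close>, together with its
  inner product.  The tensor product is specified by its universal property.  Testing it on
  scalar-valued multilinear maps is sufficient over a field: it says that the canonical linear
  map from the algebraic tensor product to this space has a bijective transpose, and such a
  linear map is bijective.
\<close>

locale mixed_tensor_space =
  V: fd_inner_product_space scaleV ipV + T: fd_inner_product_space scaleT ipT
  for scaleV :: "'k::real_or_complex \<Rightarrow> 'v::ab_group_add \<Rightarrow> 'v" and ipV :: "'v \<Rightarrow> 'v \<Rightarrow> 'k"
    and scaleT :: "'k \<Rightarrow> 't::ab_group_add \<Rightarrow> 't" and ipT :: "'t \<Rightarrow> 't \<Rightarrow> 'k" +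
  fixes n n' :: nat
    and tensor :: "'v list \<Rightarrow> ('v \<Rightarrow> 'k) list \<Rightarrow> 't"
  assumes tensor_multilinear: "mixed_multilinear scaleV scaleT n n' tensor"
    and tensor_universal: "mixed_multilinear scaleV (*) n n' f \<Longrightarrow>
      \<exists>!h. Vector_Spaces.linear scaleT (*) h \<and>
           (\<forall>(vs, \<alpha>s) \<in> tensor_args scaleV n n'. h (tensor vs \<alpha>s) = f vs \<alpha>s)"
    and ip_tensor: "(vs, \<alpha>s) \<in> tensor_args scaleV n n' \<Longrightarrow> (ws, \<beta>s) \<in> tensor_args scaleV n n' \<Longrightarrow>
      ipT (tensor vs \<alpha>s) (tensor ws \<beta>s) =
        (\<Prod>i<n. ipV (vs ! i) (ws ! i)) * (\<Prod>j<n'. dual_ip ipV (\<alpha>s ! j) (\<beta>s ! j))"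

definition multi_indices :: "nat \<Rightarrow> nat \<Rightarrow> nat \<Rightarrow> (nat list \<times> nat list) set" where
  "multi_indices m n n' =
     {(is, is'). length is = n \<and> length is' = n' \<and> set is \<subseteq> {..<m} \<and> set is' \<subseteq> {..<m}}"

definition tensor_basis ::
  "('k::field \<Rightarrow> 'v::ab_group_add \<Rightarrow> 'v) \<Rightarrow> ('v list \<Rightarrow> ('v \<Rightarrow> 'k) list \<Rightarrow> 't) \<Rightarrow>
   nat \<Rightarrow> (nat \<Rightarrow> 'v) \<Rightarrow> nat list \<times> nat list \<Rightarrow> 't" where
  "tensor_basis scaleV tensor m e I =
     tensor (map e (fst I)) (map (dual_basis scaleV m e) (snd I))"

definition tensor_component ::
  "('k::field \<Rightarrow> 'v::ab_group_add \<Rightarrow> 'v) \<Rightarrow> ('k \<Rightarrow> 't::ab_group_add \<Rightarrow> 't) \<Rightarrow> nat \<Rightarrow> nat \<Rightarrow>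
   ('v list \<Rightarrow> ('v \<Rightarrow> 'k) list \<Rightarrow> 't) \<Rightarrow> nat \<Rightarrow> (nat \<Rightarrow> 'v) \<Rightarrow> 't \<Rightarrow> nat list \<times> nat list \<Rightarrow> 'k"
  where
  "tensor_component scaleV scaleT n n' tensor m e x I =
     module.representation scaleT (tensor_basis scaleV tensor m e ` multi_indices m n n') x
       (tensor_basis scaleV tensor m e I)"

section \<open>Compact Lie groups\<close>

text \<open>
  Real \<open>d\<close>-space, for an arbitrary \<open>d\<close> including 0 (finite groups are Lie groups), is the
  library's \<^const>\<open>Euclidean_space\<close>, whose points are the sequences vanishing from index
  \<open>d\<close> on.
\<close>

primrec Ck_on :: "nat \<Rightarrow> nat \<Rightarrow> (nat \<Rightarrow> real) set \<Rightarrow> ((nat \<Rightarrow> real) \<Rightarrow> real) \<Rightarrow> bool" where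
  "Ck_on 0 d U f \<longleftrightarrow> continuous_map (subtopology (Euclidean_space d) U) euclideanreal f"
| "Ck_on (Suc k) d U f \<longleftrightarrow>
     continuous_map (subtopology (Euclidean_space d) U) euclideanreal f \<and>
     (\<exists>D. \<forall>i<d. (\<forall>x\<in>U. ((\<lambda>t. f (x(i := t))) has_real_derivative D i x) (at (x i))) \<and>
                 Ck_on k d U (D i))"

definition smooth_map_on ::
  "nat \<Rightarrow> nat \<Rightarrow> (nat \<Rightarrow> real) set \<Rightarrow> ((nat \<Rightarrow> real) \<Rightarrow> nat \<Rightarrow> real) \<Rightarrow> bool" where
  "smooth_map_on d d' U f \<longleftrightarrow>
     openin (Euclidean_space d) U \<and> f ` U \<subseteq> topspace (Euclidean_space d') \<and>
     (\<forall>j<d'. \<forall>k. Ck_on k d U (\<lambda>x. f x j))"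

text \<open>The two halves of a point of real \<open>(d + d)\<close>-space.\<close>

definition left_half :: "nat \<Rightarrow> (nat \<Rightarrow> real) \<Rightarrow> nat \<Rightarrow> real" where
  "left_half d z = (\<lambda>i. if i < d then z i else 0)"

definition right_half :: "nat \<Rightarrow> (nat \<Rightarrow> real) \<Rightarrow> nat \<Rightarrow> real" where
  "right_half d z = (\<lambda>i. if i < d then z (d + i) else 0)"

text \<open>
  Group operation and inverse are continuous and, in the charts of the given smooth atlas, smooth.
  For charts \<open>\<phi>, \<psi>, \<kappa>\<close> the coordinate expression of the multiplication is
  \<open>(x, y) \<mapsto> \<kappa> (\<phi>\<inverse> x \<otimes> \<psi>\<inverse> y)\<close>, on the open set where it is defined.
\<close>

locale lie_group = group G
  for G :: "('g, 'b) monoid_scheme" (structure) +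
  fixes X :: "'g topology" and d :: nat and atlas :: "('g set \<times> ('g \<Rightarrow> nat \<Rightarrow> real)) set"
  assumes topspace_eq: "topspace X = carrier G"
    and Hausdorff: "Hausdorff_space X"
    and second_countable: "second_countable X"
    and chart_open: "(U, \<phi>) \<in> atlas \<Longrightarrow> openin X U"
    and chart_image_open: "(U, \<phi>) \<in> atlas \<Longrightarrow> openin (Euclidean_space d) (\<phi> ` U)"
    and chart_homeomorphic: "(U, \<phi>) \<in> atlas \<Longrightarrow>
      homeomorphic_map (subtopology X U) (subtopology (Euclidean_space d) (\<phi> ` U)) \<phi>"
    and charts_cover: "\<Union> (fst ` atlas) = carrier G"
    and charts_compatible: "(U, \<phi>) \<in> atlas \<Longrightarrow> (W, \<psi>) \<in> atlas \<Longrightarrow>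
      smooth_map_on d d (\<phi> ` (U \<inter> W)) (\<lambda>x. \<psi> (inv_into U \<phi> x))"
    and mult_continuous: "continuous_map (prod_topology X X) X (\<lambda>(g, h). g \<otimes> h)"
    and inv_continuous: "continuous_map X X (\<lambda>g. inv g)"
    and mult_smooth: "(U, \<phi>) \<in> atlas \<Longrightarrow> (W, \<psi>) \<in> atlas \<Longrightarrow> (Y, \<kappa>) \<in> atlas \<Longrightarrow>
      smooth_map_on (d + d) d
        {z \<in> topspace (Euclidean_space (d + d)).
           left_half d z \<in> \<phi> ` U \<and> right_half d z \<in> \<psi> ` W \<and>
           inv_into U \<phi> (left_half d z) \<otimes> inv_into W \<psi> (right_half d z) \<in> Y}
        (\<lambda>z. \<kappa> (inv_into U \<phi> (left_half d z) \<otimes> inv_into W \<psi> (right_half d z)))"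
    and inv_smooth: "(U, \<phi>) \<in> atlas \<Longrightarrow> (W, \<psi>) \<in> atlas \<Longrightarrow>
      smooth_map_on d d {x \<in> \<phi> ` U. inv (inv_into U \<phi> x) \<in> W}
        (\<lambda>x. \<psi> (inv (inv_into U \<phi> x)))"

locale compact_lie_group = lie_group +
  assumes compact: "compact_space X"

text \<open>
  Left-invariant Borel probability measures.  On a compact Lie group there is exactly one, and it
  is also right-invariant and regular.
\<close>

definition normalized_haar_measure ::
  "('g, 'b) monoid_scheme \<Rightarrow> 'g topology \<Rightarrow> 'g measure \<Rightarrow> bool" where
  "normalized_haar_measure G X \<mu> \<longleftrightarrow>
     space \<mu> = carrier G \<and>
     sets \<mu> = sigma_sets (carrier G) {U. openin X U} \<and>
     emeasure \<mu> (carrier G) = 1 \<and>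
     (\<forall>g\<in>carrier G. \<forall>S\<in>sets \<mu>. emeasure \<mu> (g <#\<^bsub>G\<^esub> S) = emeasure \<mu> S)"

section \<open>Representations\<close>

text \<open>
  Multiplicativity makes every \<open>\<rho> g\<close> invertible.  Continuous homomorphisms from a Lie group
  to a general linear group are automatically smooth.
\<close>

locale isometric_representation =
  group G + fd_inner_product_space scaleV ipV
  for G :: "('g, 'b) monoid_scheme" (structure) and X :: "'g topology"
    and scaleV :: "'k::real_or_complex \<Rightarrow> 'v::ab_group_add \<Rightarrow> 'v" and ipV :: "'v \<Rightarrow> 'v \<Rightarrow> 'k" +
  fixes \<rho> :: "'g \<Rightarrow> 'v \<Rightarrow> 'v"
  assumes rep_linear: "g \<in> carrier G \<Longrightarrow> Vector_Spaces.linear scaleV scaleV (\<rho> g)"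
    and rep_one: "\<rho> \<one> = id"
    and rep_mult: "g \<in> carrier G \<Longrightarrow> h \<in> carrier G \<Longrightarrow> \<rho> (g \<otimes> h) = \<rho> g \<circ> \<rho> h"
    and rep_continuous: "continuous_map X (ip_topology ipV) (\<lambda>g. \<rho> g v)"
    and rep_isometric: "g \<in> carrier G \<Longrightarrow> ipV (\<rho> g v) (\<rho> g w) = ipV v w"

definition dual_rep ::
  "('g, 'b) monoid_scheme \<Rightarrow> ('g \<Rightarrow> 'v \<Rightarrow> 'v) \<Rightarrow> 'g \<Rightarrow> ('v \<Rightarrow> 'k) \<Rightarrow> 'v \<Rightarrow> 'k" where
  "dual_rep G \<rho> g \<alpha> = \<alpha> \<circ> \<rho> (inv\<^bsub>G\<^esub> g)"

definition tensor_rep ::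
  "('g, 'b) monoid_scheme \<Rightarrow> ('k::field \<Rightarrow> 'v::ab_group_add \<Rightarrow> 'v) \<Rightarrow>
   ('k \<Rightarrow> 't::ab_group_add \<Rightarrow> 't) \<Rightarrow> nat \<Rightarrow> nat \<Rightarrow> ('v list \<Rightarrow> ('v \<Rightarrow> 'k) list \<Rightarrow> 't) \<Rightarrow>
   ('g \<Rightarrow> 'v \<Rightarrow> 'v) \<Rightarrow> 'g \<Rightarrow> 't \<Rightarrow> 't" where
  "tensor_rep G scaleV scaleT n n' tensor \<rho> g =
     (THE L. Vector_Spaces.linear scaleT scaleT L \<and>
        (\<forall>(vs, \<alpha>s) \<in> tensor_args scaleV n n'.
           L (tensor vs \<alpha>s) = tensor (map (\<rho> g) vs) (map (dual_rep G \<rho> g) \<alpha>s)))"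

definition invariants :: "('g, 'b) monoid_scheme \<Rightarrow> ('g \<Rightarrow> 't \<Rightarrow> 't) \<Rightarrow> 't set" where
  "invariants G R = {x. \<forall>g\<in>carrier G. R g x = x}"

text \<open>
  The integral of a function with values in a finite-dimensional space, or in operators on such a
  space, is characterised by integrating its images under all linear functionals; for operators it
  is taken pointwise.
\<close>

definition vector_integral ::
  "('k::real_or_complex \<Rightarrow> 't::ab_group_add \<Rightarrow> 't) \<Rightarrow> 'g measure \<Rightarrow> ('g \<Rightarrow> 't) \<Rightarrow> 't" where
  "vector_integral scaleT \<mu> f =
     (THE z. \<forall>\<phi> \<in> dual_space scaleT. has_bochner_integral \<mu> (\<lambda>g. \<phi> (f g)) (\<phi> z))"

definition operator_integral ::
  "('k::real_or_complex \<Rightarrow> 't::ab_group_add \<Rightarrow> 't) \<Rightarrow> 'g measure \<Rightarrow> ('g \<Rightarrow> 't \<Rightarrow> 't) \<Rightarrow> 't \<Rightarrow> 't" where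
  "operator_integral scaleT \<mu> F = (\<lambda>x. vector_integral scaleT \<mu> (\<lambda>g. F g x))"

section \<open>The Weingarten map\<close>

definition weingarten_map ::
  "('k::field \<Rightarrow> 'a::ab_group_add \<Rightarrow> 'a) \<Rightarrow> ('a \<Rightarrow> 'a \<Rightarrow> 'k) \<Rightarrow> ('t \<Rightarrow> 't \<Rightarrow> 'k) \<Rightarrow>
   ('a \<Rightarrow> 't) \<Rightarrow> ('a \<Rightarrow> 'a) \<Rightarrow> bool" where
  "weingarten_map scaleA ipA ipT \<tau> Wg \<longleftrightarrow>
     (let \<tau>' = adjoint_map ipA ipT \<tau>; Wg' = adjoint_map ipA ipA Wg in
        Vector_Spaces.linear scaleA scaleA Wg \<and>
        \<tau>' \<circ> \<tau> \<circ> Wg \<circ> \<tau>' \<circ> \<tau> = \<tau>' \<circ> \<tau> \<and>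
        Wg \<circ> \<tau>' \<circ> \<tau> \<circ> Wg = Wg \<and>
        Wg' \<circ> \<tau>' \<circ> \<tau> = \<tau>' \<circ> \<tau> \<circ> Wg \<and>
        \<tau>' \<circ> \<tau> \<circ> Wg' = Wg \<circ> \<tau>' \<circ> \<tau>)"

end

theory Submission
  imports Defs
begin

text \<open>
  With \<open>S = \<tau>\<^sup>* \<circ> \<tau>\<close> self-adjoint, the four equations say that \<open>Wg\<close> is the Moore--Penrose
  inverse of \<open>S\<close>: it vanishes on the orthogonal complement of the range of \<open>S\<close> and inverts \<open>S\<close> on
  this range.  Hence \<open>\<tau> \<circ> Wg \<circ> \<tau>\<^sup>*\<close> is the orthogonal projection onto the range of \<open>\<tau>\<close>.
  On the other hand \<open>T(1)\<close> is the orthogonal projection onto the invariants, because the tensor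
  representation is isometric and the Haar measure is left-invariant.
\<close>

section \<open>Finite-dimensional inner product spaces\<close>

lemma cnjg_0 [simp]: "cnjg (0::'k::real_or_complex) = 0"
  using cnjg_add[of "0::'k" 0] by simp

text \<open>Cancel the nonzero real from \<open>mult_cnjg\<close>; no class axiom mentions the reals
  directly.\<close>

lemma cnjg_of_real [simp]: "cnjg (of_real r :: 'k::real_or_complex) = of_real r"
proof (cases "r = 0")
  case False
  have "of_real r * cnjg (of_real r :: 'k) = of_real r * of_real r"
    unfolding mult_cnjg by (simp add: power2_eq_square of_real_def)
  with False show ?thesis by simp
qed simp

lemma cnjg_1 [simp]: "cnjg (1::'k::real_or_complex) = 1"
  using cnjg_of_real[of 1] by simp

lemma norm_cnjg [simp]: "norm (cnjg (x::'k::real_or_complex)) = norm x"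
proof (cases "x = 0")
  case False
  have "norm x * norm (cnjg x) = norm x * norm x"
    by (metis mult_cnjg norm_mult norm_of_real of_real_def abs_power2 power2_eq_square)
  with False show ?thesis by simp
qed simp

lemma bounded_linear_cnjg: "bounded_linear (cnjg :: 'k::real_or_complex \<Rightarrow> 'k)"
proof (rule bounded_linear_intro[where K = 1])
  fix r :: real and x :: 'k
  show "cnjg (r *\<^sub>R x) = r *\<^sub>R cnjg x"
    by (simp add: scaleR_conv_of_real cnjg_mult)
qed (simp_all add: cnjg_add)

lemma cnjg_prod: "cnjg (prod f A) = (\<Prod>x\<in>A. cnjg (f x :: 'k::real_or_complex))"
  by (induction A rule: infinite_finite_induct) (simp_all add: cnjg_mult)

context fd_inner_product_space
begin

section \<open>Sesquilinearity, Cauchy-Schwarz and the norm topology\<close>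

lemma ip_add_right: "ip x (y + z) = ip x y + ip x z"
  by (metis ip_commute ip_add_left cnjg_add)

lemma ip_scale_right: "ip x (smul c y) = cnjg c * ip x y"
  by (metis ip_commute ip_scale_left cnjg_mult)

lemma linear_ip_left: "Vector_Spaces.linear smul (*) (\<lambda>x. ip x y)"
  unfolding Vector_Spaces.linear_iff
  by (simp add: ip_add_left ip_scale_left vector_space_axioms) (simp add: vector_space_def algebra_simps)

lemma ip_zero_left [simp]: "ip 0 y = 0"
  using ip_add_left[of 0 0 y] by simp

lemma ip_zero_right [simp]: "ip x 0 = 0"
  using ip_add_right[of x 0 0] by simp

lemma ip_diff_left: "ip (x - y) z = ip x z - ip y z"
  by (metis add_diff_cancel_right' diff_add_cancel ip_add_left)

lemma ip_diff_right: "ip x (y - z) = ip x y - ip x z"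
  by (metis add_diff_cancel_right' diff_add_cancel ip_add_right)

lemma ip_sum_left: "ip (sum f A) y = (\<Sum>a\<in>A. ip (f a) y)"
  by (induction A rule: infinite_finite_induct) (simp_all add: ip_add_left)

lemma ip_sum_right: "ip x (sum f A) = (\<Sum>a\<in>A. ip x (f a))"
  by (induction A rule: infinite_finite_induct) (simp_all add: ip_add_right)

lemma ip_self_eq_0 [simp]: "ip x x = 0 \<longleftrightarrow> x = 0"
proof (cases "x = 0")
  case False
  then show ?thesis
    using ip_pos[OF False] by auto
qed simp

lemma ip_eqI: "(\<And>z. ip x z = ip y z) \<Longrightarrow> x = y"
  by (metis ip_diff_left ip_self_eq_0 right_minus_eq)

lemma ip_eqI_right: "(\<And>z. ip z x = ip z y) \<Longrightarrow> x = y"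
  by (metis ip_commute ip_eqI)

lemma ip_self: "ip x x = of_real ((ip_norm ip x)\<^sup>2)"
  using ip_pos[of x] by (cases "x = 0") (auto simp: ip_norm_def)

lemma norm_ip_self: "norm (ip x x) = (ip_norm ip x)\<^sup>2"
  by (simp add: ip_norm_def)

lemma ip_norm_nonneg [simp]: "ip_norm ip x \<ge> 0"
  by (simp add: ip_norm_def)

lemma ip_norm_eq_0 [simp]: "ip_norm ip x = 0 \<longleftrightarrow> x = 0"
  by (simp add: ip_norm_def)

lemma ip_norm_zero [simp]: "ip_norm ip 0 = 0"
  by simp

lemma pythagoras:
  assumes "ip u v = 0"
  shows "(ip_norm ip (u + v))\<^sup>2 = (ip_norm ip u)\<^sup>2 + (ip_norm ip v)\<^sup>2"
proof -
  have "ip v u = 0"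
    using assms ip_commute[of v u] by simp
  with assms have "ip (u + v) (u + v) = ip u u + ip v v"
    by (simp add: ip_add_left ip_add_right)
  then show ?thesis
    unfolding ip_self of_real_add[symmetric] of_real_eq_iff .
qed

lemma ip_norm_scale: "ip_norm ip (smul c x) = norm c * ip_norm ip x"
  by (simp add: ip_norm_def ip_scale_left ip_scale_right norm_mult real_sqrt_mult)

text \<open>The projection \<open>smul c y\<close> of \<open>x\<close> onto the line of
  \<open>y\<close> is no longer than \<open>x\<close> by Pythagoras; multiplying by the norm of
  \<open>y\<close> gives the bound.\<close>

lemma ip_Cauchy_Schwarz: "norm (ip x y) \<le> ip_norm ip x * ip_norm ip y"
proof (cases "y = 0")
  case False
  define c where "c = ip x y / ip y y"
  have xy: "ip x y = c * ip y y"
    using False by (simp add: c_def)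
  have "ip (x - smul c y) (smul c y) = 0"
    by (simp add: ip_diff_left ip_scale_left ip_scale_right xy)
  from pythagoras[OF this] have "(ip_norm ip (smul c y))\<^sup>2 \<le> (ip_norm ip x)\<^sup>2"
    by simp
  then have "norm c * ip_norm ip y \<le> ip_norm ip x"
    unfolding ip_norm_scale by (rule power2_le_imp_le) simp
  then have "norm c * ip_norm ip y * ip_norm ip y \<le> ip_norm ip x * ip_norm ip y"
    by (rule mult_right_mono) simp
  then show ?thesis
    by (simp add: xy norm_mult norm_ip_self power2_eq_square mult.assoc)
qed simp

lemma ip_norm_triangle: "ip_norm ip (x + y) \<le> ip_norm ip x + ip_norm ip y"
proof (rule power2_le_imp_le)
  have "(ip_norm ip (x + y))\<^sup>2 = norm (ip x x + ip x y + (ip y x + ip y y))"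
    unfolding norm_ip_self[symmetric] ip_add_left ip_add_right by (simp add: algebra_simps)
  also have "\<dots> \<le> norm (ip x x) + norm (ip x y) + (norm (ip y x) + norm (ip y y))"
    by (intro norm_triangle_mono order_refl)
  also have "\<dots> \<le> (ip_norm ip x)\<^sup>2 + ip_norm ip x * ip_norm ip y +
      (ip_norm ip y * ip_norm ip x + (ip_norm ip y)\<^sup>2)"
    by (intro add_mono ip_Cauchy_Schwarz) (simp_all add: norm_ip_self)
  finally show "(ip_norm ip (x + y))\<^sup>2 \<le> (ip_norm ip x + ip_norm ip y)\<^sup>2"
    by (simp add: power2_eq_square algebra_simps)
qed simp

lemma ip_norm_minus_commute: "ip_norm ip (x - y) = ip_norm ip (y - x)"
  unfolding ip_norm_def by (simp add: ip_diff_left ip_diff_right algebra_simps)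

lemma Metric_space_ip: "Metric_space UNIV (\<lambda>v w. ip_norm ip (v - w))"
proof
  show "ip_norm ip (x - z) \<le> ip_norm ip (x - y) + ip_norm ip (y - z)" for x y z
    using ip_norm_triangle[of "x - y" "y - z"] by simp
qed (simp_all add: ip_norm_minus_commute)

text \<open>Turns continuity of orbit maps into continuity of matrix coefficients, the only form in
  which continuity of the representation is used.\<close>

lemma continuous_map_ip:
  assumes "continuous_map X (ip_topology ip) f"
  shows "continuous_map X euclidean (\<lambda>g. ip (f g) w)"
proof -
  interpret M: Metric_space UNIV "\<lambda>v w. ip_norm ip (v - w)"
    by (rule Metric_space_ip)
  have "continuous_map M.mtopology euclidean (\<lambda>v. ip v w)"
    unfolding Met_TC.continuous_map_to_metric[unfolded mtopology_is_euclidean] M.topspace_mtopology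
  proof (intro ballI allI impI)
    fix v and e :: real
    assume "e > 0"
    \<comment> \<open>The summand 1 keeps the denominator positive when
      \<open>w = 0\<close>.\<close>
    define r where "r = e / (ip_norm ip w + 1)"
    have pos: "ip_norm ip w + 1 > 0"
      by (simp add: add_nonneg_pos)
    show "\<exists>U. openin M.mtopology U \<and> v \<in> U \<and> (\<forall>u\<in>U. ip u w \<in> Met_TC.mball (ip v w) e)"
    proof (intro exI conjI ballI)
      show "openin M.mtopology (M.mball v r)" "v \<in> M.mball v r"
        using \<open>e > 0\<close> pos by (auto simp: r_def)
      fix u assume u: "u \<in> M.mball v r"
      have "norm (ip (v - u) w) \<le> ip_norm ip (v - u) * ip_norm ip w"
        by (rule ip_Cauchy_Schwarz)
      also have "\<dots> \<le> ip_norm ip (v - u) * (ip_norm ip w + 1)"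
        by (simp add: mult_left_mono)
      also have "\<dots> < e"
        using u pos by (simp add: r_def field_simps)
      finally show "ip u w \<in> Met_TC.mball (ip v w) e"
        by (simp add: dist_norm ip_diff_left)
    qed
  qed
  from continuous_map_compose[OF assms[unfolded ip_topology_def] this] show ?thesis
    by (simp add: comp_def)
qed

section \<open>Orthonormal sets, orthogonal projections and coordinates\<close>

definition orthonormal :: "'v set \<Rightarrow> bool" where
  "orthonormal B \<longleftrightarrow> (\<forall>x\<in>B. \<forall>y\<in>B. ip x y = (if x = y then 1 else 0))"

lemma orthogonal_span:
  assumes "\<And>b. b \<in> B \<Longrightarrow> ip x b = 0" and "y \<in> span B"
  shows "ip x y = 0"
  using assms(2) by (induction rule: span_induct_alt) (simp_all add: ip_add_right ip_scale_right assms(1))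

lemma ip_sum_orthonormal:
  assumes "orthonormal B" "finite B" "b \<in> B"
  shows "ip (\<Sum>c\<in>B. smul (f c) c) b = f b"
proof -
  have "ip (\<Sum>c\<in>B. smul (f c) c) b = (\<Sum>c\<in>B. if c = b then f c else 0)"
    unfolding ip_sum_left using assms by (intro sum.cong) (auto simp: ip_scale_left orthonormal_def)
  with assms(2,3) show ?thesis by simp
qed

text \<open>The new vector \<open>b\<close> loses its projection \<open>p\<close> onto the span so
  far. Either nothing remains and \<open>C\<close> already serves, or the normalized remainder
  \<open>u\<close> is added.\<close>

lemma gram_schmidt:
  assumes "finite B"
  shows "\<exists>C. finite C \<and> orthonormal C \<and> span C = span B"
  using assms
proof induction
  case empty
  show ?case by (rule exI[of _ "{}"]) (simp add: orthonormal_def)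
next
  case (insert b B)
  then obtain C where C: "finite C" "orthonormal C" "span C = span B" by blast
  define p where "p = (\<Sum>c\<in>C. smul (ip b c) c)"
  have p: "p \<in> span C"
    unfolding p_def by (intro span_sum span_scale span_base)
  have orth: "ip (b - p) c = 0" if "c \<in> C" for c
    using ip_sum_orthonormal[OF C(2,1) that, of "ip b"] by (simp add: ip_diff_left p_def)
  have span: "span (insert b B) = span (insert (b - p) C)"
  proof -
    have "span (insert b B) = span (insert b C)"
      using C(3) by (metis span_insert)
    also have "\<dots> = span (insert (b - p) C)"
      using p by (intro eq_span_insert_eq) simp
    finally show ?thesis .
  qed
  show ?case
  proof (cases "b = p")
    case True
    with span C show ?thesis by (intro exI[of _ C]) (simp add: insert_absorb span_insert_0)
  next
    case False
    define r where "r = ip_norm ip (b - p)"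
    define u where "u = smul (of_real (inverse r)) (b - p)"
    have r: "r \<noteq> 0" using False by (simp add: r_def)
    have uu: "ip u u = 1"
    proof -
      have "ip u u = of_real (inverse r) * (of_real (inverse r) * ip (b - p) (b - p))"
        unfolding u_def ip_scale_left ip_scale_right cnjg_of_real by simp
      also have "\<dots> = of_real (inverse r * (inverse r * r\<^sup>2))"
        unfolding ip_self r_def[symmetric] of_real_mult by simp
      also have "inverse r * (inverse r * r\<^sup>2) = 1"
        using r by (simp add: power2_eq_square field_simps)
      finally show ?thesis by simp
    qed
    have uc: "ip u c = 0" "ip c u = 0" if "c \<in> C" for c
      using orth[OF that] ip_commute[of c u] by (simp_all add: u_def ip_scale_left)
    have "orthonormal (insert u C)"
    proof -
      have "u \<notin> C"
        using uu uc(1)[of u] by auto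
      then show ?thesis
        using C(2) unfolding orthonormal_def by (auto simp: uu uc)
    qed
    moreover have "span (insert u C) = span (insert (b - p) C)"
    proof -
      have "smul (of_real r) u = b - p"
        using r by (simp add: u_def)
      moreover have "smul (of_real r) u \<in> span (insert u C)"
        by (intro span_scale span_base) simp
      ultimately have "b - p \<in> span (insert u C)"
        by simp
      moreover have "u \<in> span (insert (b - p) C)"
        unfolding u_def by (intro span_scale span_base) simp
      ultimately show ?thesis
        unfolding span_eq by (auto intro: span_base)
    qed
    ultimately show ?thesis
      using C(1) span by (intro exI[of _ "insert u C"]) simp
  qed
qed

lemma ex_orthonormal_basis: "\<exists>C. finite C \<and> orthonormal C \<and> span C = UNIV"
  using finite_dim gram_schmidt by metis

text \<open>A basis of \<open>U\<close> is finite by dimension; after Gram-Schmidt, the sum of the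
  components of \<open>x\<close> along it is the projection.\<close>

lemma ex_orthogonal_projection:
  assumes "subspace U"
  shows "\<exists>u\<in>U. \<forall>w\<in>U. ip (x - u) w = 0"
proof -
  obtain B where B: "B \<subseteq> U" "independent B" "U \<subseteq> span B"
    by (metis basis_exists)
  obtain B0 where "finite B0" "span B0 = UNIV"
    using finite_dim by blast
  then have "finite B"
    using independent_span_bound[OF _ B(2)] by simp
  then obtain C where C: "finite C" "orthonormal C" "span C = span B"
    using gram_schmidt by blast
  have U: "U = span C"
    using B C(3) assms by (metis span_subspace)
  define u where "u = (\<Sum>c\<in>C. smul (ip x c) c)"
  have "u \<in> U"
    unfolding u_def U by (intro span_sum span_scale span_base)
  moreover have "ip (x - u) w = 0" if "w \<in> U" for w
  proof (rule orthogonal_span)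
    show "w \<in> span C" using that U by simp
    show "ip (x - u) c = 0" if "c \<in> C" for c
      using ip_sum_orthonormal[OF C(2,1) that, of "ip x"] by (simp add: ip_diff_left u_def)
  qed
  ultimately show ?thesis by blast
qed

text \<open>The remainder is orthogonal to \<open>B\<close>, hence to its span, hence to
  itself.\<close>

lemma orthonormal_expansion:
  assumes "orthonormal B" "finite B" "span B = UNIV"
  shows "x = (\<Sum>b\<in>B. smul (ip x b) b)"
proof -
  let ?s = "\<Sum>b\<in>B. smul (ip x b) b"
  have "ip (x - ?s) (x - ?s) = 0"
  proof (rule orthogonal_span)
    show "ip (x - ?s) b = 0" if "b \<in> B" for b
      using ip_sum_orthonormal[OF assms(1,2) that, of "ip x"] by (simp add: ip_diff_left)
  qed (simp add: assms(3))
  then show ?thesis by simp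
qed

lemma orthonormal_independent:
  assumes "orthonormal B" "finite B"
  shows "independent B"
  unfolding dependent_finite[OF assms(2)] by (metis assms ip_sum_orthonormal ip_zero_left)

text \<open>Makes \<open>dual_basis\<close> and \<open>tensor_component\<close>, both defined by
  \<open>representation\<close>, accessible to inner product computations.\<close>

lemma representation_orthonormal:
  assumes "orthonormal B" "finite B" "span B = UNIV" "b \<in> B"
  shows "representation B x b = ip x b"
proof -
  have "x = (\<Sum>b\<in>B. smul (representation B x b) b)"
    using sum_representation_eq[OF orthonormal_independent[OF assms(1,2)] _ assms(2) subset_refl] assms(3)
    by simp
  then show ?thesis
    using ip_sum_orthonormal[OF assms(1,2,4), of "representation B x"] by simp
qed

section \<open>Riesz representation, adjoints and the pseudoinverse\<close>

lemma riesz: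
  assumes "\<alpha> \<in> dual_space smul"
  shows "\<exists>!a. \<forall>v. \<alpha> v = ip v a"
proof -
  interpret \<alpha>: Vector_Spaces.linear smul "(*)" \<alpha>
    using assms by (simp add: dual_space_def)
  obtain B where B: "finite B" "orthonormal B" "span B = UNIV"
    using ex_orthonormal_basis by blast
  \<comment> \<open>The coefficients are conjugated because \<open>ip\<close> is conjugate-linear in
    the slot where \<open>a\<close> will stand.\<close>
  define a where "a = (\<Sum>b\<in>B. smul (cnjg (\<alpha> b)) b)"
  have "\<alpha> v = ip v a" for v
  proof -
    have "\<alpha> v = \<alpha> (\<Sum>b\<in>B. smul (ip v b) b)"
      using orthonormal_expansion[OF B(2,1,3)] by simp
    also have "\<dots> = ip v a"
      by (simp add: \<alpha>.sum \<alpha>.scale a_def ip_sum_right ip_scale_right cnjg_cnjg mult.commute)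
    finally show ?thesis .
  qed
  moreover have "c = a" if "\<forall>v. \<alpha> v = ip v c" for c
    using that calculation by (intro ip_eqI_right) simp
  ultimately show ?thesis by blast
qed

lemma riesz_vector: "\<alpha> \<in> dual_space smul \<Longrightarrow> \<alpha> v = ip v (riesz_vector ip \<alpha>)"
  using theI'[OF riesz] unfolding riesz_vector_def by blast

lemma riesz_vector_ip: "riesz_vector ip (\<lambda>v. ip v a) = a"
  unfolding riesz_vector_def by (rule the_equality) (auto intro: ip_eqI_right)

lemma ip_in_dual_space: "(\<lambda>v. ip v a) \<in> dual_space smul"
  by (simp add: dual_space_def linear_ip_left)

text \<open>Riesz, applied for each \<open>y\<close> to the functional sending \<open>x\<close> to
  \<open>ip' (f x) y\<close>, gives the witness that the choice in \<open>adjoint_map\<close>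
  requires.\<close>

lemma adjoint_map_ip:
  assumes "fd_inner_product_space smul' ip'" "Vector_Spaces.linear smul smul' f"
  shows "ip' (f x) y = ip x (adjoint_map ip ip' f y)"
proof -
  interpret W: fd_inner_product_space smul' ip' by fact
  have "\<exists>z. \<forall>x. ip' (f x) y = ip x z" for y
  proof -
    have "(\<lambda>x. ip' (f x) y) \<in> dual_space smul"
      using Vector_Spaces.linear_compose[OF assms(2) W.linear_ip_left[of y]]
      by (simp add: dual_space_def comp_def)
    then show ?thesis
      using riesz by blast
  qed
  then have "\<exists>h. \<forall>x y. ip' (f x) y = ip x (h y)"
    by metis
  from someI_ex[OF this] show ?thesis
    unfolding adjoint_map_def by blast
qed

lemma adjoint_map_ip':
  assumes "fd_inner_product_space smul' ip'" "Vector_Spaces.linear smul smul' f"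
  shows "ip (adjoint_map ip ip' f y) x = ip' y (f x)"
proof -
  interpret W: fd_inner_product_space smul' ip' by fact
  show ?thesis
    by (metis adjoint_map_ip[OF assms] ip_commute W.ip_commute)
qed

lemma linear_adjoint_map:
  assumes "fd_inner_product_space smul' ip'" "Vector_Spaces.linear smul smul' f"
  shows "Vector_Spaces.linear smul' smul (adjoint_map ip ip' f)"
proof -
  interpret W: fd_inner_product_space smul' ip' by fact
  note adj = adjoint_map_ip'[OF assms]
  show ?thesis
    unfolding Vector_Spaces.linear_iff
    by (intro conjI allI ip_eqI W.vector_space_axioms vector_space_axioms)
       (simp_all add: adj ip_add_left ip_scale_left W.ip_add_left W.ip_scale_left)
qed

text \<open>\<open>P\<close> is the orthogonal projection onto the range of \<open>S\<close>, and
  \<open>W y\<close> is the unique vector of that range which \<open>S\<close> sends to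
  \<open>P y\<close>. It exists because \<open>S\<close> kills \<open>x - P x\<close>, and it is
  unique because a self-adjoint map is injective on its range. Linearity of \<open>P\<close> and
  \<open>W\<close> follows from these uniqueness properties, so the choices made are
  harmless.\<close>

lemma moore_penrose_selfadjoint:
  assumes lin: "Vector_Spaces.linear smul smul S" and self: "\<And>x y. ip (S x) y = ip x (S y)"
  obtains W P where "Vector_Spaces.linear smul smul W"
    "\<And>x. S (W x) = P x" "\<And>x. W (S x) = P x" "\<And>x. P (S x) = S x" "\<And>x. P (W x) = W x"
    "\<And>x y. ip (P x) y = ip x (P y)"
proof -
  interpret S: Vector_Spaces.linear smul smul S by fact
  have range: "subspace (range S)"
    by (rule S.subspace_image) simp
  have "\<exists>P. \<forall>x. P x \<in> range S \<and> (\<forall>w\<in>range S. ip (x - P x) w = 0)"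
    using ex_orthogonal_projection[OF range] by metis
  then obtain P where Pr: "\<And>x. P x \<in> range S" and Po: "\<And>x w. ip (x - P x) (S w) = 0"
    by blast
  \<comment> \<open>The range meets its orthogonal complement only in 0: such a \<open>u\<close> is
    itself some \<open>S v\<close>.\<close>
  have zero: "u = 0" if u: "u \<in> range S" "\<And>w. ip u (S w) = 0" for u
  proof -
    obtain v where "u = S v" using u(1) by blast
    with u(2)[of v] show ?thesis by simp
  qed
  have P_eq: "P x = u" if u: "u \<in> range S" "\<And>w. ip (x - u) (S w) = 0" for x u
  proof -
    have "P x - u = 0"
    proof (rule zero)
      show "P x - u \<in> range S"
        using subspace_diff[OF range Pr u(1)] .
      show "ip (P x - u) (S w) = 0" for w
        using u(2)[of w] Po[of x w] by (simp add: ip_diff_left)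
    qed
    then show ?thesis by simp
  qed
  have SP: "S (P x) = S x" for x
  proof (rule ip_eqI)
    show "ip (S (P x)) z = ip (S x) z" for z
      using Po[of x z] by (simp add: self ip_diff_left)
  qed
  \<comment> \<open>By self-adjointness a kernel vector is orthogonal to the range, so
    \<open>zero\<close> applies to \<open>u - v\<close>.\<close>
  have inj: "u = v" if "u \<in> range S" "v \<in> range S" "S u = S v" for u v
  proof -
    have "u - v = 0"
    proof (rule zero)
      show "u - v \<in> range S"
        using subspace_diff[OF range that(1,2)] .
      show "ip (u - v) (S w) = 0" for w
        using that(3) by (simp add: self[symmetric] S.diff)
    qed
    then show ?thesis by simp
  qed
  have "\<exists>W. \<forall>y. W y \<in> range S \<and> S (W y) = P y"
  proof (intro choice allI)
    fix y
    obtain x where "P y = S x" using Pr[of y] by blast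
    then have "S (P x) = P y" by (simp add: SP)
    with Pr show "\<exists>u. u \<in> range S \<and> S u = P y" by blast
  qed
  then obtain W where Wr: "\<And>y. W y \<in> range S" and SW: "\<And>y. S (W y) = P y"
    by blast
  have PS: "P (S x) = S x" for x
    by (rule P_eq) auto
  have P_add: "P (x + y) = P x + P y" for x y
  proof (rule P_eq)
    show "P x + P y \<in> range S"
      using subspace_add[OF range Pr Pr] .
    show "ip (x + y - (P x + P y)) (S w) = 0" for w
      using Po[of x w] Po[of y w] by (simp add: ip_diff_left ip_add_left)
  qed
  have P_scale: "P (smul c x) = smul c (P x)" for c x
  proof (rule P_eq)
    show "smul c (P x) \<in> range S"
      using subspace_scale[OF range Pr] .
    show "ip (smul c x - smul c (P x)) (S w) = 0" for w
      using Po[of x w] by (simp add: ip_diff_left ip_scale_left)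
  qed
  show ?thesis
  proof
    show "Vector_Spaces.linear smul smul W"
      unfolding Vector_Spaces.linear_iff
    proof (intro conjI allI vector_space_axioms)
      show "W (x + y) = W x + W y" for x y
        by (rule inj) (simp_all add: Wr subspace_add[OF range] SW P_add S.add)
      show "W (smul c x) = smul c (W x)" for c x
        by (rule inj) (simp_all add: Wr subspace_scale[OF range] SW P_scale S.scale)
    qed
    show "W (S x) = P x" for x
      by (rule inj) (simp_all add: Wr Pr SW SP PS)
    show "P (W x) = W x" for x
    proof -
      obtain v where "W x = S v" using Wr[of x] by blast
      then show ?thesis by (simp add: PS)
    qed
    \<comment> \<open>Both sides equal \<open>ip (P x) (P y)\<close>.\<close>
    show "ip (P x) y = ip x (P y)" for x y
    proof -
      obtain a b where a: "P x = S a" and b: "P y = S b"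
        using Pr by (meson rangeE)
      have "ip (P x) y - ip (P x) (P y) = cnjg (ip (y - P y) (S a))"
        unfolding a ip_diff_right[symmetric] by (rule ip_commute)
      then have "ip (P x) y = ip (P x) (P y)"
        by (simp add: Po)
      also have "\<dots> = ip x (P y)"
        using Po[of x b] unfolding b ip_diff_left by simp
      finally show ?thesis .
    qed
  qed (fact SW PS)+
qed

end

section \<open>The Weingarten map\<close>

context fd_inner_product_space
begin

text \<open>With \<open>S\<close> self-adjoint, the adjoint of \<open>S \<circ> W\<close> is
  \<open>W' \<circ> S\<close>, so equations 3 and 4 become self-adjointness of
  \<open>S \<circ> W\<close> and \<open>W \<circ> S\<close>. This form avoids the adjoint of
  \<open>W\<close> later on.\<close>

lemma weingarten_mapD:
  assumes T: "fd_inner_product_space scaleT ipT" and lin: "Vector_Spaces.linear smul scaleT \<tau>"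
    and W: "weingarten_map smul ip ipT \<tau> W"
  shows "ip (adjoint_map ip ipT \<tau> (\<tau> (W x))) y = ip x (adjoint_map ip ipT \<tau> (\<tau> (W y)))"
    and "ip (W (adjoint_map ip ipT \<tau> (\<tau> x))) y = ip x (W (adjoint_map ip ipT \<tau> (\<tau> y)))"
proof -
  interpret T: fd_inner_product_space scaleT ipT by fact
  define \<tau>' where "\<tau>' = adjoint_map ip ipT \<tau>"
  define W' where "W' = adjoint_map ip ip W"
  have self: "ip (\<tau>' (\<tau> x)) y = ip x (\<tau>' (\<tau> y))" for x y
    unfolding \<tau>'_def by (metis adjoint_map_ip[OF T lin] adjoint_map_ip'[OF T lin])
  have linW: "Vector_Spaces.linear smul smul W"
    and eqs: "W' \<circ> \<tau>' \<circ> \<tau> = \<tau>' \<circ> \<tau> \<circ> W" "\<tau>' \<circ> \<tau> \<circ> W' = W \<circ> \<tau>' \<circ> \<tau>"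
    using W by (simp_all add: weingarten_map_def Let_def \<tau>'_def W'_def)
  note W' = adjoint_map_ip[OF fd_inner_product_space_axioms linW, folded W'_def]
  have eqs': "\<tau>' (\<tau> (W x)) = W' (\<tau>' (\<tau> x))" "W (\<tau>' (\<tau> x)) = \<tau>' (\<tau> (W' x))" for x
    using eqs by (simp_all add: fun_eq_iff)
  show "ip (\<tau>' (\<tau> (W x))) y = ip x (\<tau>' (\<tau> (W y)))"
    by (metis self W' eqs'(1))
  show "ip (W (\<tau>' (\<tau> x))) y = ip x (W (\<tau>' (\<tau> y)))"
    by (metis self W' eqs'(2))
qed

lemma ex1_weingarten_map:
  assumes T: "fd_inner_product_space scaleT ipT" and lin: "Vector_Spaces.linear smul scaleT \<tau>"
  shows "\<exists>!W. weingarten_map smul ip ipT \<tau> W"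
proof (rule ex_ex1I)
  interpret T: fd_inner_product_space scaleT ipT by fact
  define S where "S = adjoint_map ip ipT \<tau> \<circ> \<tau>"
  have S_def': "adjoint_map ip ipT \<tau> (\<tau> x) = S x" for x
    by (simp add: S_def)
  have self: "ip (S x) y = ip x (S y)" for x y
    unfolding S_def comp_def by (metis adjoint_map_ip[OF T lin] adjoint_map_ip'[OF T lin])
  have linS: "Vector_Spaces.linear smul smul S"
    unfolding S_def by (rule Vector_Spaces.linear_compose[OF lin linear_adjoint_map[OF T lin]])
  show "\<exists>W. weingarten_map smul ip ipT \<tau> W"
  proof -
    obtain W P where linW: "Vector_Spaces.linear smul smul W"
      and SW: "\<And>x. S (W x) = P x" and WS: "\<And>x. W (S x) = P x" and PS: "\<And>x. P (S x) = S x"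
      and PW: "\<And>x. P (W x) = W x" and P: "\<And>x y. ip (P x) y = ip x (P y)"
      using moore_penrose_selfadjoint[OF linS self] by blast
    note W' = adjoint_map_ip'[OF fd_inner_product_space_axioms linW]
    have "adjoint_map ip ip W (S x) = P x" for x
      by (rule ip_eqI) (simp only: W' self SW P)
    moreover have "S (adjoint_map ip ip W x) = P x" for x
      by (rule ip_eqI) (simp only: W' self WS P)
    moreover have "S (P x) = S x" "W (P x) = W x" for x
      by (metis SW WS PS, metis SW WS PW)
    ultimately have "weingarten_map smul ip ipT \<tau> W"
      by (simp add: weingarten_map_def Let_def linW fun_eq_iff S_def' SW WS)
    then show ?thesis by blast
  qed
  fix V W
  assume VW: "weingarten_map smul ip ipT \<tau> V" "weingarten_map smul ip ipT \<tau> W"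
  have S: "S (V (S x)) = S x" "V (S (V x)) = V x" "S (W (S x)) = S x" "W (S (W x)) = W x" for x
    using VW by (simp_all add: weingarten_map_def Let_def fun_eq_iff S_def)
  note adj = weingarten_mapD[OF T lin VW(1), unfolded S_def'] weingarten_mapD[OF T lin VW(2), unfolded S_def']
  \<comment> \<open>Penrose's argument: \<open>S W = (S V)(S W)\<close> by equation 1, and taking
    adjoints reverses the product to \<open>(S W)(S V) = S V\<close>. The same works below for
    \<open>W S\<close> and \<open>V S\<close>.\<close>
  have SVW: "S (W x) = S (V x)" for x
  proof (rule ip_eqI)
    fix y
    have "ip (S (W x)) y = ip (S (V (S (W x)))) y"
      by (simp add: S)
    also have "\<dots> = ip x (S (W (S (V y))))"
      by (simp only: adj)
    also have "\<dots> = ip (S (V x)) y"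
      by (simp add: S adj)
    finally show "ip (S (W x)) y = ip (S (V x)) y" .
  qed
  have WVS: "W (S x) = V (S x)" for x
  proof (rule ip_eqI)
    fix y
    have "ip (W (S x)) y = ip (W (S (V (S x)))) y"
      by (simp add: S)
    also have "\<dots> = ip x (V (S (W (S y))))"
      by (simp only: adj)
    also have "\<dots> = ip (V (S x)) y"
      by (simp add: S adj)
    finally show "ip (W (S x)) y = ip (V (S x)) y" .
  qed
  show "V = W"
    \<comment> \<open>\<open>V = V S V = V S W = W S W = W\<close>.\<close>
    by (metis S SVW WVS ext)
qed

lemma weingarten_map_left_inverse:
  assumes T: "fd_inner_product_space scaleT ipT" and lin: "Vector_Spaces.linear smul scaleT \<tau>"
    and W: "weingarten_map smul ip ipT \<tau> W"
  shows "\<tau> (W (adjoint_map ip ipT \<tau> (\<tau> x))) = \<tau> x"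
proof -
  interpret T: fd_inner_product_space scaleT ipT by fact
  interpret \<tau>: Vector_Spaces.linear smul scaleT \<tau> by fact
  define S where "S = adjoint_map ip ipT \<tau> \<circ> \<tau>"
  have S: "S (W (S x)) = S x"
    using W by (simp add: weingarten_map_def Let_def fun_eq_iff S_def)
  have norm: "ipT (\<tau> y) (\<tau> y) = ip (S y) y" for y
    unfolding S_def comp_def adjoint_map_ip'[OF T lin] ..
  have linS: "Vector_Spaces.linear smul smul S"
    unfolding S_def by (rule Vector_Spaces.linear_compose[OF lin linear_adjoint_map[OF T lin]])
  interpret S: Vector_Spaces.linear smul smul S by (rule linS)
  have "ipT (\<tau> (W (S x) - x)) (\<tau> (W (S x) - x)) = 0"
    unfolding norm by (simp add: S.diff S)
  then have "\<tau> (W (S x) - x) = 0"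
    by simp
  then show ?thesis
    by (simp add: \<tau>.diff S_def)
qed

text \<open>The adjoint of \<tau> vanishes on the orthogonal complement of the range of \<tau>, so
  \<open>x\<close> may be replaced by its projection \<open>z = \<tau> a\<close>, where the left
  inverse property applies.\<close>

lemma weingarten_projection:
  assumes T: "fd_inner_product_space scaleT ipT" and lin: "Vector_Spaces.linear smul scaleT \<tau>"
    and W: "weingarten_map smul ip ipT \<tau> W"
    and z: "z \<in> range \<tau>" and orth: "\<And>w. w \<in> range \<tau> \<Longrightarrow> ipT (x - z) w = 0"
  shows "\<tau> (W (adjoint_map ip ipT \<tau> x)) = z"
proof -
  interpret T: fd_inner_product_space scaleT ipT by fact
  obtain a where a: "z = \<tau> a"
    using z by blast
  have "adjoint_map ip ipT \<tau> x = adjoint_map ip ipT \<tau> (\<tau> a)"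
  proof (rule ip_eqI)
    show "ip (adjoint_map ip ipT \<tau> x) y = ip (adjoint_map ip ipT \<tau> (\<tau> a)) y" for y
      unfolding adjoint_map_ip'[OF T lin] using orth[of "\<tau> y"] a by (simp add: T.ip_diff_left)
  qed
  then show ?thesis
    using weingarten_map_left_inverse[OF T lin W] a by simp
qed

section \<open>Orthonormal bases\<close>

lemma orthonormal_basis_inj_on:
  assumes "orthonormal_basis smul ip m e"
  shows "inj_on e {..<m}"
proof (rule inj_onI)
  fix i j assume ij: "i \<in> {..<m}" "j \<in> {..<m}" "e i = e j"
  have "ip (e i) (e j) = (if i = j then 1 else 0)" "ip (e i) (e i) = 1"
    using assms ij(1,2) unfolding orthonormal_basis_def by auto
  with ij(3) show "i = j"
    by (simp split: if_splits)
qed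

text \<open>Carries the results on orthonormal sets over to indexed families.\<close>

lemma orthonormal_basis_image:
  assumes "orthonormal_basis smul ip m e"
  shows "orthonormal (e ` {..<m})" "span (e ` {..<m}) = UNIV"
  using assms orthonormal_basis_inj_on[OF assms]
  by (auto simp: orthonormal_def orthonormal_basis_def inj_on_eq_iff)

lemma orthonormal_basis_expansion:
  assumes "orthonormal_basis smul ip m e"
  shows "x = (\<Sum>i<m. smul (ip x (e i)) (e i))"
  using orthonormal_expansion[OF orthonormal_basis_image(1)[OF assms] _ orthonormal_basis_image(2)[OF assms], of x, symmetric]
  by (simp add: sum.reindex[OF orthonormal_basis_inj_on[OF assms]])

lemma dual_basis_orthonormal:
  assumes "orthonormal_basis smul ip m e" "i < m"
  shows "dual_basis smul m e i = (\<lambda>v. ip v (e i))"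
  unfolding dual_basis_def
  using representation_orthonormal[OF orthonormal_basis_image(1)[OF assms(1)] _ orthonormal_basis_image(2)[OF assms(1)]]
    assms(2) by simp

end

section \<open>Mixed tensors\<close>

lemma mixed_multilinearD:
  assumes "mixed_multilinear scaleV scaleW n n' f" "(vs, \<alpha>s) \<in> tensor_args scaleV n n'"
  shows "i < n \<Longrightarrow> f (vs[i := x + y]) \<alpha>s = f (vs[i := x]) \<alpha>s + f (vs[i := y]) \<alpha>s"
    and "i < n \<Longrightarrow> f (vs[i := scaleV c x]) \<alpha>s = scaleW c (f (vs[i := x]) \<alpha>s)"
    and "j < n' \<Longrightarrow> \<beta> \<in> dual_space scaleV \<Longrightarrow> \<gamma> \<in> dual_space scaleV \<Longrightarrow>
      f vs (\<alpha>s[j := (\<lambda>v. \<beta> v + \<gamma> v)]) = f vs (\<alpha>s[j := \<beta>]) + f vs (\<alpha>s[j := \<gamma>])"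
    and "j < n' \<Longrightarrow> \<beta> \<in> dual_space scaleV \<Longrightarrow>
      f vs (\<alpha>s[j := (\<lambda>v. c * \<beta> v)]) = scaleW c (f vs (\<alpha>s[j := \<beta>]))"
  using assms unfolding mixed_multilinear_def by blast+

lemma mixed_multilinear_linear:
  assumes f: "mixed_multilinear scaleV scaleT n n' f" and h: "Vector_Spaces.linear scaleT scaleW h"
  shows "mixed_multilinear scaleV scaleW n n' (\<lambda>vs \<alpha>s. h (f vs \<alpha>s))"
proof -
  interpret h: Vector_Spaces.linear scaleT scaleW h by fact
  show ?thesis
    unfolding mixed_multilinear_def
    by (auto simp: mixed_multilinearD[OF f] h.add h.scale)
qed

context mixed_tensor_space
begin

section \<open>Simple tensors span, and multilinear maps extend\<close>

abbreviation simple_tensors :: "'t set" where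
  "simple_tensors \<equiv> case_prod tensor ` tensor_args scaleV n n'"

text \<open>Let \<open>u\<close> be the projection of \<open>x\<close> onto the span. Pairing with
  \<open>x - u\<close> and the zero functional both extend the zero multilinear map, so the
  uniqueness half of the universal property makes them equal.\<close>

lemma span_simple_tensors: "T.span simple_tensors = UNIV"
proof -
  have "x \<in> T.span simple_tensors" for x
  proof -
    obtain u where u: "u \<in> T.span simple_tensors" "\<forall>w\<in>T.span simple_tensors. ipT (x - u) w = 0"
      using T.ex_orthogonal_projection[OF T.subspace_span] by blast
    have "mixed_multilinear scaleV (*) n n' (\<lambda>_ _. 0 :: 'k)"
      by (simp add: mixed_multilinear_def)
    from tensor_universal[OF this]
    have "h = h'" if "Vector_Spaces.linear scaleT (*) h" "Vector_Spaces.linear scaleT (*) h'"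
      "\<forall>(vs, \<alpha>s) \<in> tensor_args scaleV n n'. h (tensor vs \<alpha>s) = (0::'k)"
      "\<forall>(vs, \<alpha>s) \<in> tensor_args scaleV n n'. h' (tensor vs \<alpha>s) = (0::'k)" for h h'
      using that by blast
    moreover have "\<forall>(vs, \<alpha>s) \<in> tensor_args scaleV n n'. ipT (tensor vs \<alpha>s) (x - u) = 0"
    proof clarify
      fix vs \<alpha>s assume "(vs, \<alpha>s) \<in> tensor_args scaleV n n'"
      then have "tensor vs \<alpha>s \<in> T.span simple_tensors"
        by (intro T.span_base) auto
      with u(2) show "ipT (tensor vs \<alpha>s) (x - u) = 0"
        using T.ip_commute[of "tensor vs \<alpha>s" "x - u"] by simp
    qed
    moreover have "Vector_Spaces.linear scaleT (*) (\<lambda>y. 0 :: 'k)"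
      using T.linear_ip_left[of 0] by simp
    ultimately have "(\<lambda>y. ipT y (x - u)) = (\<lambda>y. 0)"
      using T.linear_ip_left[of "x - u"] by simp
    then have "ipT (x - u) (x - u) = 0"
      by (rule fun_cong)
    with u(1) show ?thesis by simp
  qed
  then show ?thesis by blast
qed

lemma linear_eq_on_tensors:
  assumes "Vector_Spaces.linear scaleT s f" "Vector_Spaces.linear scaleT s f'"
    and eq: "\<And>vs \<alpha>s. (vs, \<alpha>s) \<in> tensor_args scaleV n n' \<Longrightarrow> f (tensor vs \<alpha>s) = f' (tensor vs \<alpha>s)"
  shows "f x = f' x"
proof -
  interpret f: Vector_Spaces.linear scaleT s f by fact
  interpret f': Vector_Spaces.linear scaleT s f' by fact
  have "x \<in> T.span simple_tensors"
    by (simp add: span_simple_tensors)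
  then show ?thesis
    by (induction rule: T.span_induct_alt) (auto simp: f.zero f'.zero f.add f'.add f.scale f'.scale eq)
qed

text \<open>Raises the universal property from scalars to values in the tensor space: each
  coordinate of \<open>f\<close> in an orthonormal basis is extended separately. This makes the
  description in \<open>tensor_rep\<close> meaningful.\<close>

lemma ex1_linear_extension:
  assumes f: "mixed_multilinear scaleV scaleT n n' f"
  shows "\<exists>!L. Vector_Spaces.linear scaleT scaleT L \<and>
    (\<forall>(vs, \<alpha>s) \<in> tensor_args scaleV n n'. L (tensor vs \<alpha>s) = f vs \<alpha>s)"
proof (rule ex_ex1I)
  obtain B where B: "finite B" "T.orthonormal B" "T.span B = UNIV"
    using T.ex_orthonormal_basis by blast
  have "\<exists>h. \<forall>b. Vector_Spaces.linear scaleT (*) (h b) \<and>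
      (\<forall>(vs, \<alpha>s) \<in> tensor_args scaleV n n'. h b (tensor vs \<alpha>s) = ipT (f vs \<alpha>s) b)"
    by (intro choice allI ex1_implies_ex tensor_universal mixed_multilinear_linear[OF f T.linear_ip_left])
  then obtain h where h: "\<And>b. Vector_Spaces.linear scaleT (*) (h b)"
    and h_tensor: "\<And>b vs \<alpha>s. (vs, \<alpha>s) \<in> tensor_args scaleV n n' \<Longrightarrow> h b (tensor vs \<alpha>s) = ipT (f vs \<alpha>s) b"
    by blast
  define L where "L x = (\<Sum>b\<in>B. scaleT (h b x) b)" for x
  have "Vector_Spaces.linear scaleT scaleT L"
    unfolding Vector_Spaces.linear_iff
  proof (intro conjI allI T.vector_space_axioms)
    show "L (x + y) = L x + L y" for x y
      using h by (simp add: L_def Vector_Spaces.linear_iff T.scale_left_distrib sum.distrib)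
    show "L (scaleT c x) = scaleT c (L x)" for c x
      using h by (simp add: L_def Vector_Spaces.linear_iff T.scale_sum_right)
  qed
  moreover have "\<forall>(vs, \<alpha>s) \<in> tensor_args scaleV n n'. L (tensor vs \<alpha>s) = f vs \<alpha>s"
  proof clarify
    fix vs \<alpha>s assume "(vs, \<alpha>s) \<in> tensor_args scaleV n n'"
    from h_tensor[OF this] show "L (tensor vs \<alpha>s) = f vs \<alpha>s"
      using T.orthonormal_expansion[OF B(2,1,3), of "f vs \<alpha>s", symmetric] by (simp add: L_def)
  qed
  ultimately show "\<exists>L. Vector_Spaces.linear scaleT scaleT L \<and>
      (\<forall>(vs, \<alpha>s) \<in> tensor_args scaleV n n'. L (tensor vs \<alpha>s) = f vs \<alpha>s)"
    by (intro exI conjI)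
next
  fix L M
  assume L: "Vector_Spaces.linear scaleT scaleT L \<and>
      (\<forall>(vs, \<alpha>s) \<in> tensor_args scaleV n n'. L (tensor vs \<alpha>s) = f vs \<alpha>s)"
    and M: "Vector_Spaces.linear scaleT scaleT M \<and>
      (\<forall>(vs, \<alpha>s) \<in> tensor_args scaleV n n'. M (tensor vs \<alpha>s) = f vs \<alpha>s)"
  show "L = M"
    by (rule ext, rule linear_eq_on_tensors[OF conjunct1[OF L] conjunct1[OF M]]) (use L M in fastforce)
qed

lemma tensor_argsI:
  "\<lbrakk>length vs = n; length \<alpha>s = n'; set \<alpha>s \<subseteq> dual_space scaleV\<rbrakk> \<Longrightarrow> (vs, \<alpha>s) \<in> tensor_args scaleV n n'"
  by (simp add: tensor_args_def)

text \<open>Expands one slot at a time. Covectors are written as \<open>ipV v a\<close> with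
  \<open>a\<close> a Riesz vector, so that the same spanning set \<open>B\<close> serves for both
  kinds of slot.\<close>

lemma tensor_in_subspace:
  assumes U: "T.subspace U" and B: "V.span B = UNIV"
    and basis: "\<And>us ws. \<lbrakk>length us = n; length ws = n'; set us \<subseteq> B; set ws \<subseteq> B\<rbrakk>
      \<Longrightarrow> tensor us (map (\<lambda>a v. ipV v a) ws) \<in> U"
    and args: "(vs, \<alpha>s) \<in> tensor_args scaleV n n'"
  shows "tensor vs \<alpha>s \<in> U"
proof -
  note ml = mixed_multilinearD[OF tensor_multilinear tensor_argsI]
  have ip_dual: "(\<lambda>v. ipV v a) \<in> dual_space scaleV" for a
    by (rule V.ip_in_dual_space)
  \<comment> \<open>Slots from \<open>k\<close> on are restricted to \<open>B\<close>, earlier ones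
    are arbitrary; each step of the induction on \<open>k\<close> frees one more slot. At
    \<open>k = n'\<close> the restriction is vacuous.\<close>
  have covectors: "tensor us (map (\<lambda>a v. ipV v a) ws) \<in> U"
    if "length us = n" "set us \<subseteq> B" "length ws = n'" "\<forall>j<n'. k \<le> j \<longrightarrow> ws ! j \<in> B" for us ws k
    using that(3,4)
  proof (induction k arbitrary: ws)
    case 0
    then have "set ws \<subseteq> B"
      by (auto simp: in_set_conv_nth)
    with 0 that(1,2) show ?case
      by (intro basis) auto
  next
    case (Suc k)
    show ?case
    proof (cases "k < n'")
      case False
      with Suc show ?thesis by simp
    next
      case True
      let ?f = "\<lambda>a. tensor us ((map (\<lambda>a v. ipV v a) ws)[k := (\<lambda>v. ipV v a)])"
      have sub: "set (map (\<lambda>a v. ipV v a) ws) \<subseteq> dual_space scaleV"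
        using ip_dual by auto
      note ml' = ml(3,4)[OF that(1) _ sub True, unfolded length_map, OF Suc.prems(1)]
      have add: "?f (a + b) = ?f a + ?f b" for a b
        using ml'(1)[OF ip_dual ip_dual, of a b] by (simp add: V.ip_add_right)
      \<comment> \<open>The passage from \<open>a\<close> to its functional is conjugate-linear;
        subspace membership is indifferent to the conjugate.\<close>
      have scale: "?f (scaleV c a) = scaleT (cnjg c) (?f a)" for c a
        using ml'(2)[OF ip_dual, of "cnjg c" a] by (simp add: V.ip_scale_right)
      have "?f a \<in> U" if "a \<in> V.span B" for a
        using that
      proof (induction rule: V.span_induct_alt)
        case base
        have "?f 0 = 0"
          using scale[of 0 0] by simp
        then show ?case
          using T.subspace_0[OF U] by simp
      next
        case (step c x y)
        have "tensor us (map (\<lambda>a v. ipV v a) (ws[k := x])) \<in> U"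
          by (rule Suc.IH) (use Suc.prems step(1) in \<open>auto simp: nth_list_update\<close>)
        then have "?f x \<in> U"
          by (simp add: map_update)
        then show ?case
          unfolding add scale using step(2) by (intro T.subspace_add[OF U] T.subspace_scale[OF U])
      qed
      then have "?f (ws ! k) \<in> U"
        using B by simp
      then show ?thesis
        using map_update[of "\<lambda>a v. ipV v a" ws k "ws ! k"] by simp
    qed
  qed
  have vectors: "tensor us (map (\<lambda>a v. ipV v a) ws) \<in> U"
    if "length us = n" "length ws = n'" "\<forall>i<n. k \<le> i \<longrightarrow> us ! i \<in> B" for us ws k
    using that(1,3)
  proof (induction k arbitrary: us)
    case 0
    then have "set us \<subseteq> B"
      by (auto simp: in_set_conv_nth)
    with 0 that(2) show ?case
      by (intro covectors[where k = n']) auto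
  next
    case (Suc k)
    show ?case
    proof (cases "k < n")
      case False
      with Suc show ?thesis by simp
    next
      case True
      let ?f = "\<lambda>a. tensor (us[k := a]) (map (\<lambda>a v. ipV v a) ws)"
      have sub: "set (map (\<lambda>a v. ipV v a) ws) \<subseteq> dual_space scaleV"
        using ip_dual by auto
      note ml' = ml(1,2)[OF Suc.prems(1) _ sub True, unfolded length_map, OF that(2)]
      have "?f a \<in> U" if "a \<in> V.span B" for a
        using that
      proof (induction rule: V.span_induct_alt)
        case base
        have "?f 0 = 0"
          using ml'(2)[of 0 0] by simp
        then show ?case
          using T.subspace_0[OF U] by simp
      next
        case (step c x y)
        have "?f x \<in> U"
          by (rule Suc.IH) (use Suc.prems step(1) in \<open>auto simp: nth_list_update\<close>)
        then show ?case
          unfolding ml' using step(2) by (intro T.subspace_add[OF U] T.subspace_scale[OF U])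
      qed
      from this[of "us ! k"] B show ?thesis
        by simp
    qed
  qed
  define ws where "ws = map (riesz_vector ipV) \<alpha>s"
  have "map (\<lambda>a v. ipV v a) ws = \<alpha>s"
    unfolding ws_def map_map comp_def
  proof (rule map_idI)
    fix \<alpha> assume "\<alpha> \<in> set \<alpha>s"
    then have "\<alpha> \<in> dual_space scaleV"
      using args by (auto simp: tensor_args_def)
    from V.riesz_vector[OF this] show "(\<lambda>v. ipV v (riesz_vector ipV \<alpha>)) = \<alpha>"
      by (simp add: fun_eq_iff)
  qed
  moreover have "tensor vs (map (\<lambda>a v. ipV v a) ws) \<in> U"
    using args by (intro vectors[where k = n]) (auto simp: tensor_args_def ws_def)
  ultimately show ?thesis by simp
qed

section \<open>The induced orthonormal basis of the tensor space\<close>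

lemma dual_ip_functionals: "dual_ip ipV (\<lambda>v. ipV v a) (\<lambda>v. ipV v b) = ipV b a"
  by (simp add: dual_ip_def V.riesz_vector_ip)

context
  fixes m :: nat and e :: "nat \<Rightarrow> 'v"
  assumes e: "orthonormal_basis scaleV ipV m e"
begin

lemma tensor_basis_eq:
  assumes "I \<in> multi_indices m n n'"
  shows "tensor_basis scaleV tensor m e I = tensor (map e (fst I)) (map (\<lambda>a v. ipV v a) (map e (snd I)))"
proof -
  have "map (dual_basis scaleV m e) (snd I) = map (\<lambda>a v. ipV v a) (map e (snd I))"
    using assms V.dual_basis_orthonormal[OF e] by (auto simp: multi_indices_def)
  then show ?thesis
    unfolding tensor_basis_def by (rule arg_cong)
qed

lemma ip_tensor_basis:
  assumes I: "I \<in> multi_indices m n n'" and J: "J \<in> multi_indices m n n'"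
  shows "ipT (tensor_basis scaleV tensor m e I) (tensor_basis scaleV tensor m e J) = (if I = J then 1 else 0)"
proof -
  \<comment> \<open>Distinct lists of equal length differ at some position, and that factor of the
    product vanishes.\<close>
  have delta: "(\<Prod>i<k. ipV (e (xs ! i)) (e (ys ! i))) = (if xs = ys then 1 else 0)"
    if eqs: "length xs = k" "length ys = k" "set xs \<subseteq> {..<m}" "set ys \<subseteq> {..<m}" for k xs ys
  proof -
    have "ipV (e (xs ! i)) (e (ys ! i)) = (if xs ! i = ys ! i then 1 else 0)" if "i < k" for i
    proof -
      have "xs ! i < m" "ys ! i < m"
        using subsetD[OF \<open>set xs \<subseteq> _\<close> nth_mem[of i]] subsetD[OF \<open>set ys \<subseteq> _\<close> nth_mem[of i]]
          \<open>length xs = k\<close> \<open>length ys = k\<close> that by simp_all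
      then show ?thesis
        using e unfolding orthonormal_basis_def by blast
    qed
    then have "(\<Prod>i<k. ipV (e (xs ! i)) (e (ys ! i))) = (\<Prod>i<k. if xs ! i = ys ! i then 1 else 0)"
      by (intro prod.cong) auto
    also have "\<dots> = (if xs = ys then 1 else 0)"
    proof (cases "xs = ys")
      case False
      then obtain i where "i < k" "xs ! i \<noteq> ys ! i"
        using eqs(1,2) by (metis nth_equalityI)
      then have "(\<Prod>i<k. if xs ! i = ys ! i then 1 else 0 :: 'k) = 0"
        by (intro prod_zero) auto
      with False show ?thesis by simp
    qed simp
    finally show ?thesis .
  qed
  obtain xs xs' ys ys' where IJ: "I = (xs, xs')" "J = (ys, ys')"
    by fastforce
  have args: "(map e zs, map (\<lambda>a v. ipV v a) (map e zs')) \<in> tensor_args scaleV n n'"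
    if "(zs, zs') \<in> multi_indices m n n'" for zs zs'
    using that V.ip_in_dual_space by (auto simp: multi_indices_def tensor_args_def)
  have len: "length xs = n" "length ys = n" "length xs' = n'" "length ys' = n'"
    "set xs \<subseteq> {..<m}" "set ys \<subseteq> {..<m}" "set xs' \<subseteq> {..<m}" "set ys' \<subseteq> {..<m}"
    using I J IJ by (simp_all add: multi_indices_def)
  have "ipT (tensor_basis scaleV tensor m e I) (tensor_basis scaleV tensor m e J) =
      (\<Prod>i<n. ipV (map e xs ! i) (map e ys ! i)) *
      (\<Prod>j<n'. dual_ip ipV (map (\<lambda>a v. ipV v a) (map e xs') ! j) (map (\<lambda>a v. ipV v a) (map e ys') ! j))"
    unfolding IJ tensor_basis_eq[OF I[unfolded IJ]] tensor_basis_eq[OF J[unfolded IJ]] fst_conv snd_conv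
    by (rule ip_tensor[OF args[OF I[unfolded IJ]] args[OF J[unfolded IJ]]])
  \<comment> \<open>\<open>dual_ip\<close> swaps its arguments, hence the reversed order in the
    second product; a Kronecker delta is symmetric.\<close>
  also have "\<dots> = (\<Prod>i<n. ipV (e (xs ! i)) (e (ys ! i))) * (\<Prod>j<n'. ipV (e (ys' ! j)) (e (xs' ! j)))"
    by (simp add: len dual_ip_functionals)
  also have "\<dots> = (if I = J then 1 else 0)"
    by (auto simp: IJ delta len)
  finally show ?thesis .
qed

lemma finite_multi_indices: "finite (multi_indices m n n')"
proof (rule finite_subset)
  show "multi_indices m n n' \<subseteq>
      {xs. set xs \<subseteq> {..<m} \<and> length xs = n} \<times> {xs. set xs \<subseteq> {..<m} \<and> length xs = n'}"
    by (auto simp: multi_indices_def)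
qed (intro finite_cartesian_product finite_lists_length_eq finite_lessThan)

lemma span_tensor_basis: "T.span (tensor_basis scaleV tensor m e ` multi_indices m n n') = UNIV"
proof -
  let ?U = "T.span (tensor_basis scaleV tensor m e ` multi_indices m n n')"
  have "simple_tensors \<subseteq> ?U"
  proof clarify
    fix vs \<alpha>s assume args: "(vs, \<alpha>s) \<in> tensor_args scaleV n n'"
    show "tensor vs \<alpha>s \<in> ?U"
    proof (rule tensor_in_subspace[OF T.subspace_span V.orthonormal_basis_image(2)[OF e] _ args])
      fix us ws assume us: "length us = n" "set us \<subseteq> e ` {..<m}" and ws: "length ws = n'" "set ws \<subseteq> e ` {..<m}"
      have "us \<in> map e ` lists {..<m}" "ws \<in> map e ` lists {..<m}"
        using us(2) ws(2) by (auto simp flip: lists_image)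
      then obtain xs xs' where "us = map e xs" "ws = map e xs'" "set xs \<subseteq> {..<m}" "set xs' \<subseteq> {..<m}"
        by (auto simp: in_lists_conv_set)
      moreover from this us(1) ws(1) have I: "(xs, xs') \<in> multi_indices m n n'"
        by (simp add: multi_indices_def)
      ultimately show "tensor us (map (\<lambda>a v. ipV v a) ws) \<in> ?U"
        using tensor_basis_eq[OF I] by (metis T.span_base fst_conv imageI snd_conv)
    qed
  qed
  then have "T.span simple_tensors \<subseteq> ?U"
    by (rule T.span_minimal) simp
  then show ?thesis
    using span_simple_tensors by auto
qed

lemma tensor_component_eq_ip:
  assumes "I \<in> multi_indices m n n'"
  shows "tensor_component scaleV scaleT n n' tensor m e x I = ipT x (tensor_basis scaleV tensor m e I)"
proof -
  \<comment> \<open>Distinct indices give distinct tensors, since coinciding ones would have inner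
    product both 0 and 1; only then is the image set orthonormal.\<close>
  have "I = J" if "I \<in> multi_indices m n n'" "J \<in> multi_indices m n n'"
    "tensor_basis scaleV tensor m e I = tensor_basis scaleV tensor m e J" for I J
    using ip_tensor_basis[OF that(1,1)] ip_tensor_basis[OF that(1,2)] that(3)
    by (simp split: if_splits)
  then have "T.orthonormal (tensor_basis scaleV tensor m e ` multi_indices m n n')"
    unfolding T.orthonormal_def by (auto simp: ip_tensor_basis)
  from T.representation_orthonormal[OF this _ span_tensor_basis] show ?thesis
    unfolding tensor_component_def using assms by (simp add: finite_multi_indices)
qed

end

end

section \<open>The tensor representation\<close>

locale isometric_tensor_representation =
  isometric_representation G X scaleV ipV \<rho> + mixed_tensor_space scaleV ipV scaleT ipT n n' tensor
  for G :: "('g, 'b) monoid_scheme" (structure) and X :: "'g topology"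
    and scaleV :: "'k::real_or_complex \<Rightarrow> 'v::ab_group_add \<Rightarrow> 'v" and ipV :: "'v \<Rightarrow> 'v \<Rightarrow> 'k"
    and \<rho> :: "'g \<Rightarrow> 'v \<Rightarrow> 'v"
    and scaleT :: "'k \<Rightarrow> 't::ab_group_add \<Rightarrow> 't" and ipT :: "'t \<Rightarrow> 't \<Rightarrow> 'k"
    and n n' :: nat and tensor :: "'v list \<Rightarrow> ('v \<Rightarrow> 'k) list \<Rightarrow> 't"
begin

abbreviation R :: "'g \<Rightarrow> 't \<Rightarrow> 't" where
  "R \<equiv> tensor_rep G scaleV scaleT n n' tensor \<rho>"

lemma dual_rep_in_dual_space:
  assumes "g \<in> carrier G" "\<alpha> \<in> dual_space scaleV"
  shows "dual_rep G \<rho> g \<alpha> \<in> dual_space scaleV"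
  using Vector_Spaces.linear_compose[OF rep_linear[OF inv_closed[OF assms(1)]]] assms(2)
  by (simp add: dual_space_def dual_rep_def)

lemma rep_inv: "g \<in> carrier G \<Longrightarrow> \<rho> g (\<rho> (inv g) v) = v"
  using rep_mult[of g "inv g"] by (simp add: rep_one fun_eq_iff)

text \<open>Invariance of \<open>ipV\<close> moves \<open>\<rho> (inv g)\<close> across as
  \<open>\<rho> g\<close>, so the Riesz map intertwines the dual representation with \<rho>.\<close>

lemma riesz_vector_dual_rep:
  assumes g: "g \<in> carrier G" and \<alpha>: "\<alpha> \<in> dual_space scaleV"
  shows "riesz_vector ipV (dual_rep G \<rho> g \<alpha>) = \<rho> g (riesz_vector ipV \<alpha>)"
proof -
  have "dual_rep G \<rho> g \<alpha> v = ipV v (\<rho> g (riesz_vector ipV \<alpha>))" for v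
  proof -
    have "dual_rep G \<rho> g \<alpha> v = ipV (\<rho> (inv g) v) (riesz_vector ipV \<alpha>)"
      by (simp add: dual_rep_def riesz_vector[OF \<alpha>])
    also have "\<dots> = ipV (\<rho> g (\<rho> (inv g) v)) (\<rho> g (riesz_vector ipV \<alpha>))"
      using rep_isometric[OF g] by simp
    finally show ?thesis
      by (simp add: rep_inv[OF g])
  qed
  then have "dual_rep G \<rho> g \<alpha> = (\<lambda>v. ipV v (\<rho> g (riesz_vector ipV \<alpha>)))"
    by (rule ext)
  then show ?thesis
    by (simp add: riesz_vector_ip)
qed

lemma tensor_args_rep:
  assumes "g \<in> carrier G" "(vs, \<alpha>s) \<in> tensor_args scaleV n n'"
  shows "(map (\<rho> g) vs, map (dual_rep G \<rho> g) \<alpha>s) \<in> tensor_args scaleV n n'"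
  using assms dual_rep_in_dual_space by (auto simp: tensor_args_def)

lemma mixed_multilinear_rep:
  assumes g: "g \<in> carrier G"
  shows "mixed_multilinear scaleV scaleT n n'
    (\<lambda>vs \<alpha>s. tensor (map (\<rho> g) vs) (map (dual_rep G \<rho> g) \<alpha>s))"
proof -
  interpret \<rho>: Vector_Spaces.linear scaleV scaleV "\<rho> g"
    using rep_linear[OF g] .
  have dual: "dual_rep G \<rho> g (\<lambda>v. \<beta> v + \<gamma> v) = (\<lambda>v. dual_rep G \<rho> g \<beta> v + dual_rep G \<rho> g \<gamma> v)"
    "dual_rep G \<rho> g (\<lambda>v. c * \<beta> v) = (\<lambda>v. c * dual_rep G \<rho> g \<beta> v)" for \<beta> \<gamma> c
    by (simp_all add: dual_rep_def comp_def)
  note ml = mixed_multilinearD[OF tensor_multilinear tensor_args_rep[OF g]]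
  show ?thesis
    unfolding mixed_multilinear_def
    by (clarsimp simp: map_update \<rho>.add \<rho>.scale dual ml dual_rep_in_dual_space[OF g])
qed

lemma R_spec:
  assumes "g \<in> carrier G"
  shows "Vector_Spaces.linear scaleT scaleT (R g) \<and>
    (\<forall>(vs, \<alpha>s) \<in> tensor_args scaleV n n'.
      R g (tensor vs \<alpha>s) = tensor (map (\<rho> g) vs) (map (dual_rep G \<rho> g) \<alpha>s))"
  unfolding tensor_rep_def by (rule theI'[OF ex1_linear_extension[OF mixed_multilinear_rep[OF assms]]])

lemma R_linear: "g \<in> carrier G \<Longrightarrow> Vector_Spaces.linear scaleT scaleT (R g)"
  using R_spec by blast

lemma R_tensor:
  "g \<in> carrier G \<Longrightarrow> (vs, \<alpha>s) \<in> tensor_args scaleV n n' \<Longrightarrow>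
    R g (tensor vs \<alpha>s) = tensor (map (\<rho> g) vs) (map (dual_rep G \<rho> g) \<alpha>s)"
  using R_spec by fastforce

lemma dual_rep_mult:
  assumes "g \<in> carrier G" "h \<in> carrier G"
  shows "dual_rep G \<rho> (g \<otimes> h) = dual_rep G \<rho> g \<circ> dual_rep G \<rho> h"
  using assms by (simp add: fun_eq_iff dual_rep_def inv_mult_group rep_mult)

lemma R_mult:
  assumes g: "g \<in> carrier G" and h: "h \<in> carrier G"
  shows "R (g \<otimes> h) x = R g (R h x)"
proof -
  have "R (g \<otimes> h) x = (R g \<circ> R h) x"
  proof (rule linear_eq_on_tensors[OF R_linear[OF m_closed[OF g h]]
        Vector_Spaces.linear_compose[OF R_linear[OF h] R_linear[OF g]]])
    fix vs \<alpha>s assume args: "(vs, \<alpha>s) \<in> tensor_args scaleV n n'"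
    show "R (g \<otimes> h) (tensor vs \<alpha>s) = (R g \<circ> R h) (tensor vs \<alpha>s)"
      using g h
      by (simp add: R_tensor args tensor_args_rep rep_mult dual_rep_mult comp_def)
  qed
  then show ?thesis by simp
qed

lemma dual_ip_rep:
  assumes "g \<in> carrier G" "\<alpha> \<in> dual_space scaleV" "\<beta> \<in> dual_space scaleV"
  shows "dual_ip ipV (dual_rep G \<rho> g \<alpha>) (dual_rep G \<rho> g \<beta>) = dual_ip ipV \<alpha> \<beta>"
  using assms by (simp add: dual_ip_def riesz_vector_dual_rep rep_isometric)

text \<open>On simple tensors a matrix coefficient is a product of coefficients of \<rho> and
  conjugates of such, the latter from the covector slots. Continuity is read off from this
  form.\<close>

lemma ip_R_tensor:
  assumes g: "g \<in> carrier G" and args: "(vs, \<alpha>s) \<in> tensor_args scaleV n n'" "(ws, \<beta>s) \<in> tensor_args scaleV n n'"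
  shows "ipT (R g (tensor vs \<alpha>s)) (tensor ws \<beta>s) =
    (\<Prod>i<n. ipV (\<rho> g (vs ! i)) (ws ! i)) *
    cnjg (\<Prod>j<n'. ipV (\<rho> g (riesz_vector ipV (\<alpha>s ! j))) (riesz_vector ipV (\<beta>s ! j)))"
proof -
  have "dual_ip ipV (dual_rep G \<rho> g (\<alpha>s ! j)) (\<beta>s ! j) =
      cnjg (ipV (\<rho> g (riesz_vector ipV (\<alpha>s ! j))) (riesz_vector ipV (\<beta>s ! j)))" if "j < n'" for j
  proof -
    have "\<alpha>s ! j \<in> dual_space scaleV"
      using args(1) that by (auto simp: tensor_args_def)
    then show ?thesis
      unfolding dual_ip_def riesz_vector_dual_rep[OF g \<open>\<alpha>s ! j \<in> _\<close>] by (intro ip_commute)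
  qed
  with args show ?thesis
    unfolding R_tensor[OF g args(1)] ip_tensor[OF tensor_args_rep[OF g args(1)] args(2)] cnjg_prod
    by (simp add: tensor_args_def)
qed

text \<open>Both sides are linear in \<open>x\<close> and conjugate-linear in \<open>y\<close>, so
  simple tensors suffice; there every factor is invariant.\<close>

lemma R_isometric:
  assumes g: "g \<in> carrier G"
  shows "ipT (R g x) (R g y) = ipT x y"
proof -
  interpret Rg: Vector_Spaces.linear scaleT scaleT "R g"
    by (rule R_linear[OF g])
  have lin: "Vector_Spaces.linear scaleT (*) (\<lambda>x. ipT (R g x) z)" for z
    using Vector_Spaces.linear_compose[OF R_linear[OF g] T.linear_ip_left[of z]] by (simp add: comp_def)
  have simple: "ipT (R g x) (R g (tensor ws \<beta>s)) = ipT x (tensor ws \<beta>s)"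
    if ws: "(ws, \<beta>s) \<in> tensor_args scaleV n n'" for x ws \<beta>s
  proof (rule linear_eq_on_tensors[OF lin T.linear_ip_left])
    fix vs \<alpha>s assume vs: "(vs, \<alpha>s) \<in> tensor_args scaleV n n'"
    have "set \<alpha>s \<subseteq> dual_space scaleV" "set \<beta>s \<subseteq> dual_space scaleV"
      "length vs = n" "length ws = n" "length \<alpha>s = n'" "length \<beta>s = n'"
      using vs ws by (auto simp: tensor_args_def)
    then show "ipT (R g (tensor vs \<alpha>s)) (R g (tensor ws \<beta>s)) = ipT (tensor vs \<alpha>s) (tensor ws \<beta>s)"
      unfolding R_tensor[OF g vs] R_tensor[OF g ws] ip_tensor[OF vs ws]
        ip_tensor[OF tensor_args_rep[OF g vs] tensor_args_rep[OF g ws]]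
      by (simp add: rep_isometric[OF g] dual_ip_rep[OF g] subset_iff)
  qed
  have "y \<in> T.span simple_tensors"
    by (simp add: span_simple_tensors)
  then show ?thesis
    by (induction rule: T.span_induct_alt)
       (auto simp: Rg.zero Rg.add Rg.scale T.ip_add_right T.ip_scale_right simple)
qed

lemma R_continuous:
  assumes X: "topspace X = carrier G"
  shows "continuous_map X euclidean (\<lambda>g. ipT (R g x) y)"
proof -
  have mult: "continuous_map X euclidean (\<lambda>g. a g * b g)"
    if "continuous_map X euclidean a" "continuous_map X euclidean b" for a b :: "'g \<Rightarrow> 'k"
    using that by (simp add: continuous_map_atin tendsto_mult)
  have prod: "continuous_map X euclidean (\<lambda>g. \<Prod>i\<in>I. a i g)"
    if "\<And>i. continuous_map X euclidean (a i)" for I and a :: "nat \<Rightarrow> 'g \<Rightarrow> 'k"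
    using that by (simp add: continuous_map_atin tendsto_prod)
  have cnjg: "continuous_map X euclidean (\<lambda>g. cnjg (a g))"
    if "continuous_map X euclidean a" for a :: "'g \<Rightarrow> 'k"
    using that by (simp add: continuous_map_atin bounded_linear.tendsto[OF bounded_linear_cnjg])
  have ip: "continuous_map X euclidean (\<lambda>g. ipV (\<rho> g v) w)" for v w
    by (rule continuous_map_ip[OF rep_continuous])
  have simple: "continuous_map X euclidean (\<lambda>g. ipT (R g (tensor vs \<alpha>s)) (tensor ws \<beta>s))"
    if "(vs, \<alpha>s) \<in> tensor_args scaleV n n'" "(ws, \<beta>s) \<in> tensor_args scaleV n n'" for vs \<alpha>s ws \<beta>s
  proof (rule continuous_map_eq)
    show "continuous_map X euclidean (\<lambda>g. (\<Prod>i<n. ipV (\<rho> g (vs ! i)) (ws ! i)) *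
        cnjg (\<Prod>j<n'. ipV (\<rho> g (riesz_vector ipV (\<alpha>s ! j))) (riesz_vector ipV (\<beta>s ! j))))"
      by (intro mult prod cnjg ip)
  qed (simp add: X ip_R_tensor that)
  have right: "continuous_map X euclidean (\<lambda>g. ipT (R g (tensor vs \<alpha>s)) y)"
    if args: "(vs, \<alpha>s) \<in> tensor_args scaleV n n'" for vs \<alpha>s y
  proof -
    have "y \<in> T.span simple_tensors"
      by (simp add: span_simple_tensors)
    then show ?thesis
    proof (induction rule: T.span_induct_alt)
      case (step c t y)
      obtain ws \<beta>s where "t = tensor ws \<beta>s" "(ws, \<beta>s) \<in> tensor_args scaleV n n'"
        using step(1) by auto
      with step(2) show ?case
        by (simp add: T.ip_add_right T.ip_scale_right simple[OF args] continuous_map_add mult)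
    qed simp
  qed
  have "x \<in> T.span simple_tensors"
    by (simp add: span_simple_tensors)
  then show ?thesis
  proof (induction rule: T.span_induct_alt)
    case base
    \<comment> \<open>Linearity of \<open>R g\<close> is available only for \<open>g\<close> in the
      carrier, so the identities hold on \<open>topspace X\<close> alone;
      \<open>continuous_map_eq\<close> transfers continuity along them.\<close>
    have zero: "R g 0 = 0" if "g \<in> carrier G" for g
    proof -
      interpret Rg: Vector_Spaces.linear scaleT scaleT "R g"
        by (rule R_linear[OF that])
      show ?thesis by (rule Rg.zero)
    qed
    show ?case
      by (rule continuous_map_eq[of X euclidean "\<lambda>_. 0"]) (simp_all add: X zero)
  next
    case (step c t x)
    obtain vs \<alpha>s where t: "t = tensor vs \<alpha>s" "(vs, \<alpha>s) \<in> tensor_args scaleV n n'"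
      using step(1) by auto
    have eq: "ipT (R g (scaleT c t + x)) y = c * ipT (R g t) y + ipT (R g x) y" if "g \<in> carrier G" for g
    proof -
      interpret Rg: Vector_Spaces.linear scaleT scaleT "R g"
        by (rule R_linear[OF that])
      show ?thesis by (simp add: Rg.add Rg.scale T.ip_add_left T.ip_scale_left)
    qed
    have cont: "continuous_map X euclidean (\<lambda>g. c * ipT (R g t) y + ipT (R g x) y)"
      unfolding t(1) using step(2) by (intro continuous_map_add mult right t(2)) simp_all
    show ?case
      by (rule continuous_map_eq[OF cont]) (simp add: X eq)
  qed
qed

end

section \<open>Averaging over the group\<close>

context lie_group
begin

context
  fixes \<mu> :: "'g measure"
  assumes haar: "normalized_haar_measure G X \<mu>"
begin

lemma space_haar: "space \<mu> = carrier G"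
  and sets_haar: "sets \<mu> = sigma_sets (carrier G) {U. openin X U}"
  and emeasure_haar: "emeasure \<mu> (carrier G) = 1"
  and haar_l_coset: "g \<in> carrier G \<Longrightarrow> S \<in> sets \<mu> \<Longrightarrow> emeasure \<mu> (g <# S) = emeasure \<mu> S"
  using haar by (simp_all add: normalized_haar_measure_def)

lemma finite_measure_haar: "finite_measure \<mu>"
  by (rule finite_measureI) (simp add: space_haar emeasure_haar)

lemma open_sets_haar: "openin X U \<Longrightarrow> U \<in> sets \<mu>"
  unfolding sets_haar by (auto intro: sigma_sets.Basic)

lemma continuous_map_measurable_haar:
  fixes f :: "'g \<Rightarrow> 'k::topological_space"
  assumes "continuous_map X euclidean f"
  shows "f \<in> borel_measurable \<mu>"
proof (rule borel_measurableI)
  fix S :: "'k set" assume "open S"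
  then have "openin X {x \<in> topspace X. f x \<in> S}"
    using openin_continuous_map_preimage[OF assms] by simp
  moreover have "f -` S \<inter> space \<mu> = {x \<in> topspace X. f x \<in> S}"
    by (auto simp: space_haar topspace_eq)
  ultimately show "f -` S \<inter> space \<mu> \<in> sets \<mu>"
    using open_sets_haar by simp
qed

lemma measurable_left_mult:
  assumes h: "h \<in> carrier G"
  shows "(\<lambda>g. h \<otimes> g) \<in> measurable \<mu> \<mu>"
proof (rule measurable_sigma_sets[OF sets_haar])
  show "{U. openin X U} \<subseteq> Pow (carrier G)"
    using openin_subset topspace_eq by auto
  show "(\<lambda>g. h \<otimes> g) \<in> space \<mu> \<rightarrow> carrier G"
    using h by (simp add: space_haar)
  fix U assume "U \<in> {U. openin X U}"
  have "continuous_map X X ((\<lambda>(g, h). g \<otimes> h) \<circ> (\<lambda>g. (h, g)))"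
    using h by (intro continuous_map_compose[OF _ mult_continuous])
      (simp add: continuous_map_paired topspace_eq)
  then have "openin X {x \<in> topspace X. h \<otimes> x \<in> U}"
    using openin_continuous_map_preimage \<open>U \<in> _\<close> by fastforce
  moreover have "(\<lambda>g. h \<otimes> g) -` U \<inter> space \<mu> = {x \<in> topspace X. h \<otimes> x \<in> U}"
    by (auto simp: space_haar topspace_eq)
  ultimately show "(\<lambda>g. h \<otimes> g) -` U \<inter> space \<mu> \<in> sets \<mu>"
    using open_sets_haar by simp
qed

text \<open>The preimage of \<open>A\<close> under translation by \<open>h\<close> is the coset of
  \<open>A\<close> by \<open>inv h\<close>; this converts invariance on cosets into a change of
  variables for integrals.\<close>

lemma distr_left_mult:
  assumes h: "h \<in> carrier G"
  shows "distr \<mu> \<mu> (\<lambda>g. h \<otimes> g) = \<mu>"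
proof (rule measure_eqI)
  fix A assume "A \<in> sets (distr \<mu> \<mu> (\<lambda>g. h \<otimes> g))"
  then have A: "A \<in> sets \<mu>"
    by simp
  have sub: "A \<subseteq> carrier G"
    using sets.sets_into_space[OF A] by (simp add: space_haar)
  have "(\<lambda>g. h \<otimes> g) -` A \<inter> space \<mu> = inv h <# A"
  proof (intro equalityI subsetI)
    fix g assume "g \<in> (\<lambda>g. h \<otimes> g) -` A \<inter> space \<mu>"
    then have "h \<otimes> g \<in> A" "g = inv h \<otimes> (h \<otimes> g)"
      using h by (simp_all add: space_haar inv_solve_left)
    then show "g \<in> inv h <# A"
      unfolding l_coset_def by blast
  next
    fix g assume "g \<in> inv h <# A"
    then obtain a where "a \<in> A" "g = inv h \<otimes> a"
      unfolding l_coset_def by blast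
    with h sub show "g \<in> (\<lambda>g. h \<otimes> g) -` A \<inter> space \<mu>"
      by (auto simp: space_haar subset_iff simp flip: m_assoc)
  qed
  then show "emeasure (distr \<mu> \<mu> (\<lambda>g. h \<otimes> g)) A = emeasure \<mu> A"
    using emeasure_distr[OF measurable_left_mult[OF h] A] haar_l_coset[OF inv_closed[OF h] A] by simp
qed simp

lemma integral_left_mult:
  fixes f :: "'g \<Rightarrow> 'k::{banach, second_countable_topology}"
  assumes "h \<in> carrier G" "f \<in> borel_measurable \<mu>"
  shows "(\<integral>g. f (h \<otimes> g) \<partial>\<mu>) = (\<integral>g. f g \<partial>\<mu>)"
  using integral_distr[OF measurable_left_mult[OF assms(1)] assms(2)] distr_left_mult[OF assms(1)] by simp

text \<open>Membership in the invariants and orthogonality of the remainder together characterise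
  the orthogonal projection. The representation enters only through linearity, multiplicativity,
  isometry and continuity of its coefficients.\<close>

lemma operator_integral_projection:
  fixes scaleT :: "'k::real_or_complex \<Rightarrow> 't::ab_group_add \<Rightarrow> 't"
  assumes T: "fd_inner_product_space scaleT ipT"
    and linear: "\<And>g. g \<in> carrier G \<Longrightarrow> Vector_Spaces.linear scaleT scaleT (R g)"
    and mult: "\<And>g h x. g \<in> carrier G \<Longrightarrow> h \<in> carrier G \<Longrightarrow> R (g \<otimes> h) x = R g (R h x)"
    and isometric: "\<And>g x y. g \<in> carrier G \<Longrightarrow> ipT (R g x) (R g y) = ipT x y"
    and continuous: "\<And>x y. continuous_map X euclidean (\<lambda>g. ipT (R g x) y)"
  shows "operator_integral scaleT \<mu> R x \<in> invariants G R"
    and "w \<in> invariants G R \<Longrightarrow> ipT (x - operator_integral scaleT \<mu> R x) w = 0"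
proof -
  interpret T: fd_inner_product_space scaleT ipT by fact
  interpret \<mu>: finite_measure \<mu> by (rule finite_measure_haar)
  have meas: "(\<lambda>g. ipT (R g x) y) \<in> borel_measurable \<mu>" for x y
    by (rule continuous_map_measurable_haar[OF continuous])
  have int: "integrable \<mu> (\<lambda>g. ipT (R g x) y)" for x y
  proof (rule \<mu>.integrable_const_bound[where B = "ip_norm ipT x * ip_norm ipT y", OF _ meas])
    have "norm (ipT (R g x) y) \<le> ip_norm ipT x * ip_norm ipT y" if "g \<in> carrier G" for g
      using T.ip_Cauchy_Schwarz[of "R g x" y] isometric[OF that, of x x] by (simp add: ip_norm_def)
    then show "AE g in \<mu>. norm (ipT (R g x) y) \<le> ip_norm ipT x * ip_norm ipT y"
      by (intro AE_I2) (simp add: space_haar)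
  qed
  obtain B where B: "finite B" "T.orthonormal B" "T.span B = UNIV"
    using T.ex_orthonormal_basis by blast
  \<comment> \<open>The integral is assembled from its coordinates; \<open>ip_z\<close> then frees
    it from the choice of \<open>B\<close>.\<close>
  define z where "z = (\<Sum>b\<in>B. scaleT (\<integral>g. ipT (R g x) b \<partial>\<mu>) b)"
  have ip_z: "ipT z w = (\<integral>g. ipT (R g x) w \<partial>\<mu>)" for w
  proof -
    have parseval: "(\<Sum>b\<in>B. ipT y b * ipT b w) = ipT y w" for y
    proof -
      have "(\<Sum>b\<in>B. ipT y b * ipT b w) = ipT (\<Sum>b\<in>B. scaleT (ipT y b) b) w"
        by (simp add: T.ip_sum_left T.ip_scale_left)
      then show ?thesis
        by (simp add: T.orthonormal_expansion[OF B(2,1,3), symmetric])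
    qed
    have "ipT z w = (\<Sum>b\<in>B. (\<integral>g. ipT (R g x) b * ipT b w \<partial>\<mu>))"
      by (simp add: z_def T.ip_sum_left T.ip_scale_left)
    also have "\<dots> = (\<integral>g. (\<Sum>b\<in>B. ipT (R g x) b * ipT b w) \<partial>\<mu>)"
      using int by (intro Bochner_Integration.integral_sum[symmetric]) simp
    also have "\<dots> = (\<integral>g. ipT (R g x) w \<partial>\<mu>)"
      unfolding parseval ..
    finally show ?thesis .
  qed
  have z: "operator_integral scaleT \<mu> R x = z"
    unfolding operator_integral_def vector_integral_def
  proof (rule the_equality)
    show "\<forall>\<phi>\<in>dual_space scaleT. has_bochner_integral \<mu> (\<lambda>g. \<phi> (R g x)) (\<phi> z)"
    proof
      fix \<phi> assume "\<phi> \<in> dual_space scaleT"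
      from T.riesz_vector[OF this] show "has_bochner_integral \<mu> (\<lambda>g. \<phi> (R g x)) (\<phi> z)"
        by (simp add: has_bochner_integral_iff int ip_z)
    qed
    fix y assume y: "\<forall>\<phi>\<in>dual_space scaleT. has_bochner_integral \<mu> (\<lambda>g. \<phi> (R g x)) (\<phi> y)"
    show "y = z"
    proof (rule T.ip_eqI)
      fix w
      have "has_bochner_integral \<mu> (\<lambda>g. ipT (R g x) w) (ipT y w)"
        using bspec[OF y T.ip_in_dual_space[of w]] .
      then show "ipT y w = ipT z w"
        by (simp add: has_bochner_integral_iff ip_z)
    qed
  qed
  have "R h z = z" if h: "h \<in> carrier G" for h
  proof (rule T.ip_eqI)
    fix w
    \<comment> \<open>The Riesz vector \<open>a\<close> of this functional lets \<open>R h\<close>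
      pass under the integral through \<open>ip_z\<close>, where it becomes a left
      translation.\<close>
    have "(\<lambda>y. ipT (R h y) w) \<in> dual_space scaleT"
      using Vector_Spaces.linear_compose[OF linear[OF h] T.linear_ip_left[of w]]
      by (simp add: dual_space_def comp_def)
    from T.riesz_vector[OF this] obtain a where a: "\<And>y. ipT (R h y) w = ipT y a"
      by blast
    have "ipT (R h z) w = (\<integral>g. ipT (R h (R g x)) w \<partial>\<mu>)"
      unfolding a ip_z ..
    also have "\<dots> = (\<integral>g. ipT (R (h \<otimes> g) x) w \<partial>\<mu>)"
      by (intro Bochner_Integration.integral_cong refl) (simp add: space_haar mult h)
    also have "\<dots> = ipT z w"
      unfolding ip_z by (rule integral_left_mult[OF h meas])
    finally show "ipT (R h z) w = ipT z w" .
  qed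
  then show "operator_integral scaleT \<mu> R x \<in> invariants G R"
    by (simp add: z invariants_def)
  assume w: "w \<in> invariants G R"
  have "ipT z w = (\<integral>g. ipT x w \<partial>\<mu>)"
    unfolding ip_z
  proof (intro Bochner_Integration.integral_cong refl)
    fix g assume "g \<in> space \<mu>"
    then show "ipT (R g x) w = ipT x w"
      \<comment> \<open>An invariant \<open>w\<close> equals \<open>R g w\<close>, so isometry
        removes \<open>g\<close> and leaves a constant integrand on a space of mass 1.\<close>
      using isometric[of g x w] w by (simp add: space_haar invariants_def)
  qed
  also have "\<dots> = ipT x w"
    by (simp add: measure_def space_haar emeasure_haar)
  finally show "ipT (x - operator_integral scaleT \<mu> R x) w = 0"
    by (simp add: z T.ip_diff_left)
qed

end

end

theorem theorem4p6:
  fixes G :: "('g, 'b) monoid_scheme" and X :: "'g topology" and d :: nat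
    and atlas :: "('g set \<times> ('g \<Rightarrow> nat \<Rightarrow> real)) set" and \<mu> :: "'g measure"
    and scaleV :: "'k::real_or_complex \<Rightarrow> 'v::ab_group_add \<Rightarrow> 'v" and ipV :: "'v \<Rightarrow> 'v \<Rightarrow> 'k"
    and \<rho> :: "'g \<Rightarrow> 'v \<Rightarrow> 'v"
    and n n' :: nat
    and scaleT :: "'k \<Rightarrow> 't::ab_group_add \<Rightarrow> 't" and ipT :: "'t \<Rightarrow> 't \<Rightarrow> 'k"
    and tensor :: "'v list \<Rightarrow> ('v \<Rightarrow> 'k) list \<Rightarrow> 't"
    and scaleA :: "'k \<Rightarrow> 'a::ab_group_add \<Rightarrow> 'a" and ipA :: "'a \<Rightarrow> 'a \<Rightarrow> 'k"
    and \<tau> :: "'a \<Rightarrow> 't"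
  assumes "compact_lie_group G X d atlas"
    and "normalized_haar_measure G X \<mu>"
    and "isometric_representation G X scaleV ipV \<rho>"
    and "mixed_tensor_space scaleV ipV scaleT ipT n n' tensor"
    and "fd_inner_product_space scaleA ipA"
    and "Vector_Spaces.linear scaleA scaleT \<tau>"
  shows "(\<exists>!Wg. weingarten_map scaleA ipA ipT \<tau> Wg) \<and>
    (let R = tensor_rep G scaleV scaleT n n' tensor \<rho>;
         T1 = operator_integral scaleT \<mu> R
     in range \<tau> = invariants G R \<longrightarrow>
      (\<forall>Wg. weingarten_map scaleA ipA ipT \<tau> Wg \<longrightarrow>
        T1 = \<tau> \<circ> Wg \<circ> adjoint_map ipA ipT \<tau> \<and>
        (\<forall>m e p a. orthonormal_basis scaleV ipV m e \<longrightarrow> orthonormal_basis scaleA ipA p a \<longrightarrow>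
           (\<forall>I \<in> multi_indices m n n'. \<forall>J \<in> multi_indices m n n'.
              tensor_component scaleV scaleT n n' tensor m e
                (T1 (tensor_basis scaleV tensor m e J)) I =
              (\<Sum>k<p. \<Sum>l<p.
                 tensor_component scaleV scaleT n n' tensor m e (\<tau> (a k)) I *
                 cnjg (tensor_component scaleV scaleT n n' tensor m e (\<tau> (a l)) J) *
                 ipA (Wg (a l)) (a k))))))"
proof -
  interpret L: compact_lie_group G X d atlas by fact
  interpret \<rho>: isometric_representation G X scaleV ipV \<rho> by fact
  interpret M: mixed_tensor_space scaleV ipV scaleT ipT n n' tensor by fact
  interpret \<rho>: isometric_tensor_representation G X scaleV ipV \<rho> scaleT ipT n n' tensor ..
  interpret A: fd_inner_product_space scaleA ipA by fact
  note T = M.T.fd_inner_product_space_axioms and lin = assms(6)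
  define \<tau>' where "\<tau>' = adjoint_map ipA ipT \<tau>"
  define R where "R = tensor_rep G scaleV scaleT n n' tensor \<rho>"
  define T1 where "T1 = operator_integral scaleT \<mu> R"
  note projection = L.operator_integral_projection[OF assms(2) T \<rho>.R_linear \<rho>.R_mult \<rho>.R_isometric
      \<rho>.R_continuous[OF L.topspace_eq], folded R_def, folded T1_def]
  have T1: "T1 = \<tau> \<circ> W \<circ> \<tau>'" if "range \<tau> = invariants G R" "weingarten_map scaleA ipA ipT \<tau> W" for W
    \<comment> \<open>\<open>T1 x\<close> plays the role of \<open>z\<close>; rewriting the range of
      \<tau> as the invariants turns both premises into the two facts on averaging.\<close>
    using A.weingarten_projection[OF T lin that(2), of "T1 x" x for x, folded \<tau>'_def, unfolded that(1)] projection
    by (simp add: fun_eq_iff)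
  have coefficients: "tensor_component scaleV scaleT n n' tensor m e
        (T1 (tensor_basis scaleV tensor m e J)) I =
      (\<Sum>k<p. \<Sum>l<p.
         tensor_component scaleV scaleT n n' tensor m e (\<tau> (a k)) I *
         cnjg (tensor_component scaleV scaleT n n' tensor m e (\<tau> (a l)) J) *
         ipA (W (a l)) (a k))"
    if range: "range \<tau> = invariants G R" and W: "weingarten_map scaleA ipA ipT \<tau> W"
      and e: "orthonormal_basis scaleV ipV m e" and a: "orthonormal_basis scaleA ipA p a"
      and I: "I \<in> multi_indices m n n'" and J: "J \<in> multi_indices m n n'" for W m e p a I J
  proof -
    let ?e = "tensor_basis scaleV tensor m e"
    interpret W: Vector_Spaces.linear scaleA scaleA W
      using W by (simp add: weingarten_map_def Let_def)
    note adj = A.adjoint_map_ip[OF T lin, folded \<tau>'_def] A.adjoint_map_ip'[OF T lin, folded \<tau>'_def]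
    have parseval: "ipA x y = (\<Sum>k<p. ipA x (a k) * ipA (a k) y)" for x y
    proof -
      have "(\<Sum>k<p. ipA x (a k) * ipA (a k) y) = ipA (\<Sum>k<p. scaleA (ipA x (a k)) (a k)) y"
        by (simp add: A.ip_sum_left A.ip_scale_left)
      then show ?thesis
        by (simp add: A.orthonormal_basis_expansion[OF a, symmetric])
    qed
    have "W x = (\<Sum>l<p. scaleA (ipA x (a l)) (W (a l)))" for x
    proof -
      have "W (\<Sum>l<p. scaleA (ipA x (a l)) (a l)) = (\<Sum>l<p. scaleA (ipA x (a l)) (W (a l)))"
        by (simp add: W.sum W.scale)
      then show ?thesis
        by (simp add: A.orthonormal_basis_expansion[OF a, symmetric])
    qed
    then have W_left: "ipA (W x) y = (\<Sum>l<p. ipA x (a l) * ipA (W (a l)) y)" for x y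
      by (metis (no_types, lifting) A.ip_scale_left A.ip_sum_left sum.cong)
    \<comment> \<open>Moving the outer \<tau> across leaves a matrix element of \<open>W\<close>
      between two adjoint images. The sum over \<open>k\<close> comes from inserting the basis
      between them, the sum over \<open>l\<close> from expanding the argument of
      \<open>W\<close>.\<close>
    have "ipT (T1 (?e J)) (?e I) = ipA (W (\<tau>' (?e J))) (\<tau>' (?e I))"
      by (simp add: T1[OF range W] adj)
    also have "\<dots> = (\<Sum>k<p. ipA (W (\<tau>' (?e J))) (a k) * ipT (\<tau> (a k)) (?e I))"
      unfolding adj(1) by (rule parseval)
    also have "\<dots> = (\<Sum>k<p. (\<Sum>l<p. ipT (?e J) (\<tau> (a l)) * ipA (W (a l)) (a k)) * ipT (\<tau> (a k)) (?e I))"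
      unfolding W_left[of "\<tau>' (?e J)"] adj(2) ..
    also have "\<dots> = (\<Sum>k<p. \<Sum>l<p. ipT (\<tau> (a k)) (?e I) * cnjg (ipT (\<tau> (a l)) (?e J)) * ipA (W (a l)) (a k))"
      \<comment> \<open>Here the conjugate arises: the \<open>l\<close>-coefficient has
        \<open>\<tau> (a l)\<close> in the second slot, whereas a component has it in the
        first.\<close>
      unfolding M.T.ip_commute[symmetric] by (simp add: sum_distrib_left sum_distrib_right mult_ac)
    finally show ?thesis
      by (simp add: M.tensor_component_eq_ip[OF e] I J)
  qed
  show ?thesis
    unfolding Let_def R_def[symmetric] T1_def[symmetric] \<tau>'_def[symmetric]
    using A.ex1_weingarten_map[OF T lin] T1 coefficients by blast
qed

end
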